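(* Let $\mathcal{A}$ be a unital pre-$C^*$-algebra which is algebraically amenable (as a complex algebra). Then its closure (completion) $\overline{\mathcal{A}}$ is a Følner $C^*$-algebra.
   Context: A unital pre-$C^*$-algebra is a unital complex $*$-algebra with a norm satisfying all properties of a $C^*$-norm except possibly completeness; $\overline{\mathcal{A}}$ denotes its $C^*$-completion. Algebraic amenability: a complex algebra $\mathcal{A}$ is (left) algebraically amenable if for every $\varepsilon>0$ and every finite set $\mathcal{F}\subset\mathcal{A}$ there is a nonzero finite-dimensional linear subspace $W\subset\mathcal{A}$ such that $\dim(aW+W)\le(1+\varepsilon)\dim(W)$ for all $a\in\mathcal{F}$. Følner $C^*$-algebra: a unital $C^*$-algebra $\mathcal{B}$ is Følner if there is a net of unital completely positive maps $\varphi_i\colon\mathcal{B}\to M_{k(i)}(\mathbb{C})$ (with $k(i)\ge 1$) such that $\lim_i\|\varphi_i(AB)-\varphi_i(A)\varphi_i(B)\|_{2,\mathrm{tr}}=0$ for all $A,B\in\mathcal{B}$, where $\|F\|_{2,\mathrm{tr}}=\sqrt{\mathrm{tr}(F^*F)}$ and $\mathrm{tr}$ is the unique tracial state on the matrix algebra $M_{k(i)}(\mathbb{C})$. *)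

theory Defs
  imports "HOL-Analysis.Elementary_Topology" "Jordan_Normal_Form.Matrix"
begin

section \<open>Complex algebras and algebraic amenability\<close>

class complex_algebra = ring +
  fixes scaleC :: "complex \<Rightarrow> 'a \<Rightarrow> 'a"  (infixr "*\<^sub>C" 75)
  assumes scaleC_add_right: "c *\<^sub>C (x + y) = c *\<^sub>C x + c *\<^sub>C y"
    and scaleC_add_left: "(c + d) *\<^sub>C x = c *\<^sub>C x + d *\<^sub>C x"
    and scaleC_scaleC: "c *\<^sub>C d *\<^sub>C x = (c * d) *\<^sub>C x"
    and scaleC_one: "1 *\<^sub>C x = x"
    and mult_scaleC_left: "(c *\<^sub>C x) * y = c *\<^sub>C (x * y)"
    and mult_scaleC_right: "x * (c *\<^sub>C y) = c *\<^sub>C (x * y)"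

global_interpretation complex_vs:
  vector_space "scaleC :: complex \<Rightarrow> 'a \<Rightarrow> 'a::complex_algebra"
  by unfold_locales (fact scaleC_add_right scaleC_add_left scaleC_scaleC scaleC_one)+

definition finite_dim_subspace :: "'a::complex_algebra set \<Rightarrow> bool" where
  "finite_dim_subspace W \<longleftrightarrow>
     complex_vs.subspace W \<and> (\<exists>B. finite B \<and> complex_vs.span B = W)"

definition algebraically_amenable :: "'a::complex_algebra itself \<Rightarrow> bool" where
  "algebraically_amenable _ \<longleftrightarrow>
     (\<forall>\<epsilon>::real. \<forall>F::'a set. \<epsilon> > 0 \<longrightarrow> finite F \<longrightarrow>
       (\<exists>W. finite_dim_subspace W \<and> W \<noteq> {0} \<and>
         (\<forall>a\<in>F. real (complex_vs.dim {a * v + w | v w. v \<in> W \<and> w \<in> W})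
                   \<le> (1 + \<epsilon>) * real (complex_vs.dim W))))"


section \<open>Unital pre-C*-algebras, C*-algebras and completions\<close>

class star =
  fixes star :: "'a \<Rightarrow> 'a"

text \<open>
  \<^class>\<open>real_normed_algebra_1\<close> contributes the norm axioms, submultiplicativity,
  \<open>1 \<noteq> 0\<close> and \<open>norm 1 = 1\<close>. In a nonzero algebra the last one is a consequence of
  the C*-identity; the zero algebra is neither algebraically amenable nor a Foelner algebra.
\<close>

class pre_cstar_algebra = real_normed_algebra_1 + complex_algebra + star +
  assumes scaleR_eq_scaleC: "r *\<^sub>R x = complex_of_real r *\<^sub>C x"
    and norm_scaleC: "norm (c *\<^sub>C x) = cmod c * norm x"
    and star_star: "star (star x) = x"
    and star_add: "star (x + y) = star x + star y"
    and star_scaleC: "star (c *\<^sub>C x) = cnj c *\<^sub>C star x"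
    and star_mult: "star (x * y) = star y * star x"
    and cstar_identity: "norm (star x * x) = (norm x)\<^sup>2"

class cstar_algebra = pre_cstar_algebra + complete_space

instantiation complex :: cstar_algebra
begin

definition scaleC_complex :: "complex \<Rightarrow> complex \<Rightarrow> complex" where
  "scaleC_complex c x = c * x"

definition star_complex :: "complex \<Rightarrow> complex" where
  "star_complex x = cnj x"

instance
  by standard
    (auto simp: scaleC_complex_def star_complex_def algebra_simps norm_mult
      power2_eq_square scaleR_conv_of_real)

end

definition unital_star_hom :: "('a::pre_cstar_algebra \<Rightarrow> 'b::pre_cstar_algebra) \<Rightarrow> bool" where
  "unital_star_hom \<iota> \<longleftrightarrow>
     (\<forall>x y. \<iota> (x + y) = \<iota> x + \<iota> y) \<and>
     (\<forall>c x. \<iota> (c *\<^sub>C x) = c *\<^sub>C \<iota> x) \<and>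
     (\<forall>x y. \<iota> (x * y) = \<iota> x * \<iota> y) \<and>
     (\<forall>x. \<iota> (star x) = star (\<iota> x)) \<and>
     \<iota> 1 = 1"

text \<open>
  The completion is only determined up to a unique isometric isomorphism compatible with the
  embeddings; it is represented by an arbitrary C*-algebra \<open>'b\<close> together with the embedding.
\<close>

definition cstar_completion :: "('a::pre_cstar_algebra \<Rightarrow> 'b::cstar_algebra) \<Rightarrow> bool" where
  "cstar_completion \<iota> \<longleftrightarrow>
     unital_star_hom \<iota> \<and> (\<forall>x. norm (\<iota> x) = norm x) \<and> closure (range \<iota>) = UNIV"


section \<open>Unital completely positive maps into matrix algebras\<close>

definition mat_star :: "'a::star mat \<Rightarrow> 'a mat" where
  "mat_star X = Matrix.mat (dim_col X) (dim_row X) (\<lambda>(i, j). star (X $$ (j, i)))"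

text \<open>Positivity in the C*-algebra of \<open>n \<times> n\<close> matrices over the C*-algebra \<open>'a\<close>.\<close>

definition mat_positive :: "nat \<Rightarrow> 'a::cstar_algebra mat \<Rightarrow> bool" where
  "mat_positive n X \<longleftrightarrow> (\<exists>Y \<in> carrier_mat n n. X = mat_star Y * Y)"

text \<open>
  The amplification of \<open>\<phi>\<close> to \<open>n \<times> n\<close> matrices. A matrix of size \<open>n\<close> over the
  \<open>k \<times> k\<close> complex matrices is identified with the complex matrix of size \<open>n * k\<close>
  whose \<open>(i, j)\<close> block of size \<open>k\<close> is its \<open>(i, j)\<close> entry.
\<close>

definition amplification ::
  "nat \<Rightarrow> nat \<Rightarrow> ('a \<Rightarrow> complex mat) \<Rightarrow> 'a mat \<Rightarrow> complex mat" where
  "amplification n k \<phi> X = Matrix.mat (n * k) (n * k)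
     (\<lambda>(r, s). \<phi> (X $$ (r div k, s div k)) $$ (r mod k, s mod k))"

definition unital_completely_positive ::
  "nat \<Rightarrow> ('a::cstar_algebra \<Rightarrow> complex mat) \<Rightarrow> bool" where
  "unital_completely_positive k \<phi> \<longleftrightarrow>
     (\<forall>x. \<phi> x \<in> carrier_mat k k) \<and>
     (\<forall>x y. \<phi> (x + y) = \<phi> x + \<phi> y) \<and>
     (\<forall>c x. \<phi> (c *\<^sub>C x) = c \<cdot>\<^sub>m \<phi> x) \<and>
     \<phi> 1 = 1\<^sub>m k \<and>
     (\<forall>n. \<forall>X \<in> carrier_mat n n.
        mat_positive n X \<longrightarrow> mat_positive (n * k) (amplification n k \<phi> X))"

definition normalized_trace :: "complex mat \<Rightarrow> complex" where
  "normalized_trace F = (\<Sum>i<dim_row F. F $$ (i, i)) / of_nat (dim_row F)"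

definition norm_2_tr :: "complex mat \<Rightarrow> real" where
  "norm_2_tr F = sqrt (Re (normalized_trace (mat_star F * F)))"


section \<open>Nets and Foelner C*-algebras\<close>

definition directed_set :: "'i set \<Rightarrow> ('i \<Rightarrow> 'i \<Rightarrow> bool) \<Rightarrow> bool" where
  "directed_set I R \<longleftrightarrow>
     I \<noteq> {} \<and>
     (\<forall>i\<in>I. R i i) \<and>
     (\<forall>i\<in>I. \<forall>j\<in>I. \<forall>l\<in>I. R i j \<longrightarrow> R j l \<longrightarrow> R i l) \<and>
     (\<forall>i\<in>I. \<forall>j\<in>I. \<exists>l\<in>I. R i l \<and> R j l)"

definition net_tendsto ::
  "'i set \<Rightarrow> ('i \<Rightarrow> 'i \<Rightarrow> bool) \<Rightarrow> ('i \<Rightarrow> 'x::metric_space) \<Rightarrow> 'x \<Rightarrow> bool" where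
  "net_tendsto I R x l \<longleftrightarrow>
     (\<forall>e>0. \<exists>i\<^sub>0\<in>I. \<forall>i\<in>I. R i\<^sub>0 i \<longrightarrow> dist (x i) l < e)"

definition folner_net ::
  "'i set \<Rightarrow> ('i \<Rightarrow> 'i \<Rightarrow> bool) \<Rightarrow> ('i \<Rightarrow> nat) \<Rightarrow> ('i \<Rightarrow> 'a::cstar_algebra \<Rightarrow> complex mat) \<Rightarrow> bool"
  where
  "folner_net I R k \<phi> \<longleftrightarrow>
     directed_set I R \<and>
     (\<forall>i\<in>I. k i \<ge> 1 \<and> unital_completely_positive (k i) (\<phi> i)) \<and>
     (\<forall>A B. net_tendsto I R (\<lambda>i. norm_2_tr (\<phi> i (A * B) - \<phi> i A * \<phi> i B)) 0)"

text \<open>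
  HOL cannot quantify existentially over the type of indices of the net. Fixing it to
  \<open>'a set \<times> nat\<close> is no restriction: see the lemma \<open>folner_cstar_algebraI\<close>, in which the
  index type is arbitrary.
\<close>

definition folner_cstar_algebra :: "'a::cstar_algebra itself \<Rightarrow> bool" where
  "folner_cstar_algebra _ \<longleftrightarrow>
     (\<exists>(I :: ('a set \<times> nat) set) R k (\<phi> :: 'a set \<times> nat \<Rightarrow> 'a \<Rightarrow> complex mat).
        folner_net I R k \<phi>)"

lemma directed_set_finite_upper_bound:
  assumes "directed_set I R" "finite P" "\<forall>p\<in>P. f p \<in> I"
  shows "\<exists>j\<in>I. \<forall>p\<in>P. R (f p) j"
  using assms(2,3)
proof (induction P rule: finite_induct)
  case empty
  have "I \<noteq> {}" using assms(1) unfolding directed_set_def by blast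
  then show ?case by blast
next
  case (insert p P)
  then obtain j where j: "j \<in> I" "\<forall>q\<in>P. R (f q) j" by auto
  obtain l where l: "l \<in> I" "R j l" "R (f p) l"
    using assms(1) j(1) insert.prems unfolding directed_set_def by blast
  have "R (f q) l" if "q \<in> P" for q
  proof -
    have "f q \<in> I" "R (f q) j" using that j insert.prems by auto
    moreover have "\<forall>i\<in>I. \<forall>j\<in>I. \<forall>l\<in>I. R i j \<longrightarrow> R j l \<longrightarrow> R i l"
      using assms(1) unfolding directed_set_def by blast
    ultimately show ?thesis using j(1) l by blast
  qed
  with l show ?case by auto
qed

lemma folner_cstar_algebraI:
  fixes I :: "'i set" and \<phi> :: "'i \<Rightarrow> 'a::cstar_algebra \<Rightarrow> complex mat"
  assumes net: "folner_net I R k \<phi>"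
  shows "folner_cstar_algebra TYPE('a)"
proof -
  define d where "d i A B = norm_2_tr (\<phi> i (A * B) - \<phi> i A * \<phi> i B)" for i A B
  have dir: "directed_set I R" using net unfolding folner_net_def by blast
  have "\<exists>i\<in>I. \<forall>A\<in>fst s. \<forall>B\<in>fst s. dist (d i A B) 0 < inverse (real (Suc (snd s)))"
    if fin: "finite (fst s)" for s :: "'a set \<times> nat"
  proof -
    have "\<forall>p. \<exists>i\<^sub>0\<in>I. \<forall>i\<in>I. R i\<^sub>0 i \<longrightarrow>
        dist (d i (fst p) (snd p)) 0 < inverse (real (Suc (snd s)))"
    proof
      fix p :: "'a \<times> 'a"
      have "net_tendsto I R (\<lambda>i. d i (fst p) (snd p)) 0"
        using net unfolding folner_net_def d_def by blast
      moreover have "inverse (real (Suc (snd s))) > 0" by simp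
      ultimately show "\<exists>i\<^sub>0\<in>I. \<forall>i\<in>I. R i\<^sub>0 i \<longrightarrow>
          dist (d i (fst p) (snd p)) 0 < inverse (real (Suc (snd s)))"
        unfolding net_tendsto_def by blast
    qed
    from choice[OF this[unfolded Bex_def]] obtain f where f: "\<forall>p. f p \<in> I \<and> (\<forall>i\<in>I. R (f p) i \<longrightarrow>
        dist (d i (fst p) (snd p)) 0 < inverse (real (Suc (snd s))))"
      by blast
    have "finite (fst s \<times> fst s)" "\<forall>p\<in>fst s \<times> fst s. f p \<in> I"
      using fin f by simp_all
    from directed_set_finite_upper_bound[OF dir this]
    obtain j where j: "j \<in> I" "\<forall>p\<in>fst s \<times> fst s. R (f p) j"
      by blast
    show ?thesis
    proof (intro bexI[of _ j] ballI)
      fix A B assume "A \<in> fst s" "B \<in> fst s"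
      then have "R (f (A, B)) j" using j(2) by simp
      with f j(1) have "dist (d j (fst (A, B)) (snd (A, B))) 0 < inverse (real (Suc (snd s)))"
        by blast
      then show "dist (d j A B) 0 < inverse (real (Suc (snd s)))" by simp
    qed (fact j(1))
  qed
  then have "\<forall>s. \<exists>i. finite (fst s) \<longrightarrow> i \<in> I \<and>
      (\<forall>A\<in>fst s. \<forall>B\<in>fst s. dist (d i A B) 0 < inverse (real (Suc (snd s))))"
    by blast
  from choice[OF this] obtain g where g: "\<And>s. finite (fst s) \<Longrightarrow> g s \<in> I"
    "\<And>s A B. finite (fst s) \<Longrightarrow> A \<in> fst s \<Longrightarrow> B \<in> fst s \<Longrightarrow>
       dist (d (g s) A B) 0 < inverse (real (Suc (snd s)))"
    by blast
  define J :: "('a set \<times> nat) set" where "J = {s. finite (fst s)}"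
  define R' :: "'a set \<times> nat \<Rightarrow> 'a set \<times> nat \<Rightarrow> bool" where
    "R' s t \<longleftrightarrow> fst s \<subseteq> fst t \<and> snd s \<le> snd t" for s t
  have ub: "\<exists>l\<in>J. R' s l \<and> R' t l" if "s \<in> J" "t \<in> J" for s t
    using that by (intro bexI[of _ "(fst s \<union> fst t, max (snd s) (snd t))"])
      (auto simp: J_def R'_def)
  have "({}, 0) \<in> J" by (simp add: J_def)
  then have "J \<noteq> {}" by blast
  moreover have "R' s s" "R' s t \<Longrightarrow> R' t u \<Longrightarrow> R' s u" for s t u
    by (auto simp: R'_def)
  ultimately have "directed_set J R'"
    unfolding directed_set_def using ub by blast
  moreover have "net_tendsto J R' (\<lambda>s. d (g s) A B) 0" for A B
    unfolding net_tendsto_def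
  proof (intro allI impI)
    fix e :: real assume "e > 0"
    then obtain n where n: "inverse (real (Suc n)) < e" using reals_Archimedean by blast
    have "dist (d (g s) A B) 0 < e" if "s \<in> J" "R' ({A, B}, n) s" for s
    proof -
      have "dist (d (g s) A B) 0 < inverse (real (Suc (snd s)))"
        using that by (intro g) (auto simp: J_def R'_def)
      also have "\<dots> \<le> inverse (real (Suc n))"
        using that by (intro le_imp_inverse_le) (auto simp: R'_def)
      finally show ?thesis using n by linarith
    qed
    then show "\<exists>i\<^sub>0\<in>J. \<forall>i\<in>J. R' i\<^sub>0 i \<longrightarrow> dist (d (g i) A B) 0 < e"
      by (intro bexI[of _ "({A, B}, n)"] ballI impI) (simp_all add: J_def)
  qed
  moreover have "\<forall>s\<in>J. k (g s) \<ge> 1 \<and> unital_completely_positive (k (g s)) (\<phi> (g s))"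
    using net g(1) unfolding J_def folner_net_def by blast
  ultimately have "folner_net J R' (\<lambda>s. k (g s)) (\<lambda>s. \<phi> (g s))"
    unfolding folner_net_def d_def by blast
  then show ?thesis unfolding folner_cstar_algebra_def by blast
qed

end

theory Submission
  imports Defs "HOL-Analysis.Elementary_Metric_Spaces" "HOL-Library.Function_Algebras"
begin

text \<open>
  For a finite-dimensional subspace \<open>W\<close> of the algebra there is a positive functional \<open>F\<close> on the
  completion with \<open>F (v\<^sup>* v) > 0\<close> for all nonzero \<open>v \<in> W\<close>. Such functionals come from the
  Hahn--Banach theorem and from Kaplansky's theorem that every \<open>x\<^sup>* x\<close> is the square of a
  self-adjoint element. The space \<open>W\<close> then embeds into the GNS space of \<open>F\<close>, and the compression
  \<open>\<phi> x = P x P\<close> by the projection \<open>P\<close> onto its image is unital and completely positive. If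
  \<open>dim (b W + W) \<le> (1 + \<epsilon>) dim W\<close>, then \<open>(1 - P) b P\<close> has rank at most \<open>\<epsilon> dim W\<close>, so that
  \<open>\<phi> (a b) - \<phi> a \<phi> b = P a (1 - P) b P\<close> has normalized Hilbert--Schmidt norm at most
  \<open>sqrt \<epsilon> \<parallel>a\<parallel> \<parallel>b\<parallel>\<close>. Elements of the completion are approximated in norm.
\<close>

section \<open>Squares of self-adjoint elements\<close>

text \<open>Amenability counts the dimension of \<open>W\<close> in the algebra, whereas the
  compression lives on the image of \<open>W\<close> in a Hilbert space. If the image were smaller,
  the ratio of dimensions would say nothing about the trace; hence \<open>F\<close> must be faithful
  on \<open>W\<close>. It is built for each \<open>W\<close> separately because a positive
  functional faithful on the whole completion need not exist. Positivity of \<open>F\<close> is the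
  obstacle: Hahn-Banach controls values only through norms, so positivity of
  \<open>star x * x\<close> must first become a norm inequality such as \<parallel>1 - x\<parallel>
  \<le> 1. For squares of self-adjoint elements such inequalities come from algebraic identities and
  the C*-identity; Kaplansky's theorem extends them to all \<open>star x * x\<close>. Elements of
  the algebra stand for the vectors of the GNS space. The \<open>sqrt \<epsilon>\<close> arises
  because the squared Hilbert-Schmidt norm is at most the rank times the squared operator norm, and
  the normalized trace divides by \<open>dim W\<close>.\<close>

instance cstar_algebra \<subseteq> banach ..

section \<open>The involution of a pre-C*-algebra\<close>

lemma norm_star [simp]: "norm (star x) = norm (x::'a::pre_cstar_algebra)"
proof -
  have le: "norm x \<le> norm (star x)" for x :: 'a
  proof (cases "x = 0")
    case False
    have "norm x * norm x \<le> norm (star x) * norm x"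
      using norm_mult_ineq[of "star x" x] by (simp add: cstar_identity power2_eq_square)
    with False show ?thesis by simp
  qed simp
  show ?thesis using le[of x] le[of "star x"] by (simp add: star_star)
qed

lemma star_scaleR: "star (r *\<^sub>R x) = r *\<^sub>R star (x::'a::pre_cstar_algebra)"
  by (simp add: scaleR_eq_scaleC star_scaleC)

lemma bounded_linear_star: "bounded_linear (star :: 'a::pre_cstar_algebra \<Rightarrow> 'a)"
  by (rule bounded_linear_intro[where K = 1]) (simp_all add: star_add star_scaleR)

lemmas star_zero = linear_0[OF bounded_linear.linear[OF bounded_linear_star]]
  and star_diff = linear_diff[OF bounded_linear.linear[OF bounded_linear_star]]
  and star_minus = linear_neg[OF bounded_linear.linear[OF bounded_linear_star]]
  and star_sum = linear_sum[OF bounded_linear.linear[OF bounded_linear_star]]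

lemma star_one: "star 1 = (1::'a::pre_cstar_algebra)"
  by (metis mult.left_neutral mult.right_neutral star_mult star_star)

lemma norm_square_selfadjoint: "star h = h \<Longrightarrow> norm (h * h) = (norm (h::'a::pre_cstar_algebra))\<^sup>2"
  using cstar_identity[of h] by simp

text \<open>Since \<open>(1 - c)\<^sup>2 = 1 - h\<close> means \<open>c = (h + c\<^sup>2) / 2\<close>, \<open>c\<close> is found by fixed point iteration;
  the same iteration for the real number \<open>h = 1\<close> is a majorant.\<close>

lemma sqrt_one_minus:
  fixes h :: "'a::cstar_algebra"
  assumes h: "norm h \<le> 1" and sa: "star h = h"
  obtains c where "star c = c" "norm c \<le> 1" "(1 - c) * (1 - c) = 1 - h"
    "\<And>x. h * x = x * h \<Longrightarrow> c * x = x * c"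
proof -
  define c where "c = rec_nat 0 (\<lambda>_ x. (1/2) *\<^sub>R (h + x * x))"
  define r where "r = rec_nat (0::real) (\<lambda>_ x. (1 + x * x) / 2)"
  have c0: "c 0 = 0" and cS: "c (Suc n) = (1/2) *\<^sub>R (h + c n * c n)" for n
    by (simp_all add: c_def)
  have r0: "r 0 = 0" and rS: "r (Suc n) = (1 + r n * r n) / 2" for n
    by (simp_all add: r_def)
  have r_bounds: "0 \<le> r n \<and> r n \<le> 1" for n
    by (induction n) (auto simp: r0 rS mult_le_one)
  have c_le: "norm (c n) \<le> r n" for n
  proof (induction n)
    case (Suc n)
    have "norm (c (Suc n)) \<le> (norm h + norm (c n) * norm (c n)) / 2"
      using norm_triangle_ineq[of h "c n * c n"] norm_mult_ineq[of "c n" "c n"]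
      by (simp add: cS)
    also have "\<dots> \<le> r (Suc n)"
      using h mult_mono[OF Suc Suc] r_bounds[of n] by (simp add: rS)
    finally show ?case .
  qed (simp add: c0 r0)
  have increment: "norm (c (Suc n) - c n) \<le> r (Suc n) - r n" for n
  proof (induction n)
    case 0
    show ?case using h by (simp add: c0 r0 cS rS)
  next
    case (Suc n)
    let ?d = "c (Suc n) - c n"
    \<comment> \<open>Difference of squares without commutation:
      \<open>x * x - y * y = x * (x - y) + (x - y) * y\<close>. For the scalars \<open>r\<close> the
      same formula is the recursion of the majorant.\<close>
    have "c (Suc (Suc n)) - c (Suc n) = (1/2) *\<^sub>R (c (Suc n) * ?d + ?d * c n)"
      by (simp add: cS[of "Suc n"] cS[of n, symmetric] scaleR_diff_right[symmetric])
        (simp add: cS algebra_simps)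
    then have "norm (c (Suc (Suc n)) - c (Suc n)) \<le>
        (norm (c (Suc n)) * norm ?d + norm ?d * norm (c n)) / 2"
      using norm_triangle_ineq[of "c (Suc n) * ?d" "?d * c n"]
        norm_mult_ineq[of "c (Suc n)" ?d] norm_mult_ineq[of ?d "c n"] by simp
    also have "\<dots> \<le> (r (Suc n) * (r (Suc n) - r n) + (r (Suc n) - r n) * r n) / 2"
      using Suc c_le r_bounds order.trans[OF norm_ge_zero Suc]
      by (intro divide_right_mono add_mono mult_mono) auto
    also have "\<dots> = r (Suc (Suc n)) - r (Suc n)"
      by (simp add: rS[of "Suc n"] rS[of n]) (simp add: rS field_simps)
    finally show ?case .
  qed
  have dist_c: "norm (c m - c n) \<le> r m - r n" if "n \<le> m" for m n
    using that
  proof (induction m rule: dec_induct)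
    case (step m)
    then show ?case
      using norm_triangle_ineq[of "c (Suc m) - c m" "c m - c n"] increment[of m]
      by simp
  qed simp
  have "incseq r"
    using order.trans[OF norm_ge_zero increment] by (intro incseq_SucI) simp
  then have "convergent r"
    using r_bounds by (intro Bseq_mono_convergent BseqI'[where K = 1]) (auto simp: incseq_def)
  then have "Cauchy r" by (rule convergent_Cauchy)
  have "Cauchy c"
  proof (rule CauchyI)
    fix e :: real assume "e > 0"
    then obtain M where M: "\<And>m n. m \<ge> M \<Longrightarrow> n \<ge> M \<Longrightarrow> norm (r m - r n) < e"
      using \<open>Cauchy r\<close> unfolding Cauchy_iff by blast
    have "norm (c m - c n) < e" if "m \<ge> M" "n \<ge> M" for m n
      using dist_c[of n m] dist_c[of m n] M[OF that] by (cases "n \<le> m") (auto simp: norm_minus_commute)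
    then show "\<exists>M. \<forall>m\<ge>M. \<forall>n\<ge>M. norm (c m - c n) < e" by blast
  qed
  then obtain l where l: "c \<longlonglongrightarrow> l" using Cauchy_convergent convergent_def by blast
  have "star (c n) = c n" for n
    by (induction n) (simp_all add: c0 cS star_zero star_scaleR star_add star_mult sa)
  then have "star l = l"
    using bounded_linear.tendsto[OF bounded_linear_star l] l LIMSEQ_unique by fastforce
  moreover have "norm l \<le> 1"
    using c_le r_bounds by (intro LIMSEQ_le_const2[OF tendsto_norm[OF l]]) (meson order.trans)
  moreover have "(1 - l) * (1 - l) = 1 - h"
  proof -
    have "(\<lambda>n. c (Suc n)) \<longlonglongrightarrow> (1/2) *\<^sub>R (h + l * l)"
      unfolding cS by (intro tendsto_intros l)
    then have "l = (1/2) *\<^sub>R (h + l * l)"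
      using LIMSEQ_Suc[OF l] LIMSEQ_unique by blast
    then have "2 *\<^sub>R l = 2 *\<^sub>R ((1/2) *\<^sub>R (h + l * l))" by (rule arg_cong)
    then have "l + l = h + l * l" by (simp add: scaleR_2)
    then show ?thesis by (simp add: algebra_simps)
  qed
  moreover have "l * x = x * l" if "h * x = x * h" for x
  proof -
    have "c n * x = x * c n" for n
    proof (induction n)
      case (Suc n)
      then have "c n * c n * x = x * (c n * c n)" by (metis mult.assoc)
      then show ?case by (simp add: cS distrib_left distrib_right that)
    qed (simp add: c0)
    then have "(\<lambda>n. x * c n) \<longlonglongrightarrow> l * x" using tendsto_mult[OF l tendsto_const[of x]] by simp
    then show ?thesis using tendsto_mult[OF tendsto_const[of x] l] LIMSEQ_unique by blast
  qed
  ultimately show ?thesis by (rule that)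
qed

text \<open>\<open>a + i b\<close> is a multiple of a unitary with real part \<open>a\<close>.\<close>

lemma norm_le_sum_commuting_squares:
  fixes a b :: "'a::pre_cstar_algebra"
  assumes a: "star a = a" and b: "star b = b" and ab: "a * b = b * a"
    and eq: "a * a + b * b = t *\<^sub>R 1"
  shows "(norm a)\<^sup>2 \<le> \<bar>t\<bar>"
proof -
  define u where "u = a + \<i> *\<^sub>C b"
  have su: "star u = a + (- \<i>) *\<^sub>C b"
    by (simp add: u_def star_add star_scaleC a b)
  have "star u * u = a * a + b * b"
    unfolding su by (simp add: u_def algebra_simps mult_scaleC_left mult_scaleC_right
      scaleC_scaleC scaleC_one ab)
  then have nu: "(norm u)\<^sup>2 = \<bar>t\<bar>"
    using cstar_identity[of u] eq by simp
  have "star u + u = 2 *\<^sub>R a"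
    unfolding su by (simp add: u_def scaleR_2)
  then have "2 * norm a = norm (star u + u)" by simp
  also have "\<dots> \<le> 2 * norm u" using norm_triangle_ineq[of "star u" u] by simp
  finally have "(norm a)\<^sup>2 \<le> (norm u)\<^sup>2" by (intro power_mono) auto
  with nu show ?thesis by simp
qed

text \<open>The partner \<open>s\<close> is to \<open>h\<close> as sine is to cosine; such commuting
  pairs are what \<open>norm_le_sum_commuting_squares\<close> can be applied to.\<close>

lemma complement_of_square:
  fixes h :: "'a::cstar_algebra"
  assumes h: "norm h \<le> 1" and sa: "star h = h"
  obtains s where "star s = s" "s * s = 1 - h * h" "h * s = s * h"
proof -
  have "norm (h * h) \<le> 1"
    using norm_mult_ineq[of h h] h by (meson mult_le_one norm_ge_zero order.trans)
  moreover have "star (h * h) = h * h" by (simp add: star_mult sa)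
  ultimately obtain c where c: "star c = c" "norm c \<le> 1" "(1 - c) * (1 - c) = 1 - h * h"
    "\<And>x. h * h * x = x * (h * h) \<Longrightarrow> c * x = x * c"
    by (rule sqrt_one_minus) blast
  have "c * h = h * c" by (rule c(4)) (simp add: mult.assoc)
  then show ?thesis
    using c(1,3) by (intro that[of "1 - c"]) (simp_all add: star_diff star_one algebra_simps)
qed

text \<open>In \<open>s * s + h * h = 1\<close> the roles of sine and cosine may be exchanged, so
  \<open>s\<close> has norm at most 1. The triangle inequality alone would give only the bound
  2.\<close>

lemma norm_one_minus_square:
  fixes h :: "'a::cstar_algebra"
  assumes "norm h \<le> 1" "star h = h"
  shows "norm (1 - h * h) \<le> 1"
proof -
  obtain s where s: "star s = s" "s * s = 1 - h * h" "h * s = s * h"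
    using complement_of_square[OF assms] .
  have "(norm s)\<^sup>2 \<le> \<bar>1\<bar>"
    by (rule norm_le_sum_commuting_squares[of s h]) (use s assms in auto)
  then show ?thesis using norm_square_selfadjoint[OF s(1)] s(2) by simp
qed

text \<open>Double angles: \<open>2 *\<^sub>R (h * h) - 1\<close> and
  \<open>2 *\<^sub>R (h * s)\<close> commute, and their squares again add up to 1.\<close>

lemma norm_two_square_minus_one:
  fixes h :: "'a::cstar_algebra"
  assumes "norm h \<le> 1" "star h = h"
  shows "norm (2 *\<^sub>R (h * h) - 1) \<le> 1"
proof -
  obtain s where s: "star s = s" "s * s = 1 - h * h" "h * s = s * h"
    using complement_of_square[OF assms] .
  have hhs: "h * h * s = s * (h * h)" using s(3) by (metis mult.assoc)
  have hhss: "h * s * (h * s) = h * h * (s * s)" using s(3) by (metis mult.assoc)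
  define a where "a = 2 *\<^sub>R (h * h) - 1"
  have "(norm a)\<^sup>2 \<le> \<bar>1\<bar>"
  proof (rule norm_le_sum_commuting_squares[of _ "2 *\<^sub>R (h * s)"])
    show "star a = a" by (simp add: a_def star_diff star_scaleR star_mult star_one assms)
    show "star (2 *\<^sub>R (h * s)) = 2 *\<^sub>R (h * s)" by (simp add: star_scaleR star_mult assms s)
    have "h * h * (h * s) = h * s * (h * h)" using hhs by (metis mult.assoc)
    then show "a * 2 *\<^sub>R (h * s) = 2 *\<^sub>R (h * s) * a"
      by (simp add: a_def algebra_simps)
    have aa: "a * a = 4 *\<^sub>R (h * h * (h * h)) - 4 *\<^sub>R (h * h) + 1"
    proof -
      have "a * a = 4 *\<^sub>R (h * h * (h * h)) - (2 *\<^sub>R (h * h) + 2 *\<^sub>R (h * h)) + 1"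
        by (simp add: a_def algebra_simps)
      then show ?thesis by (simp add: scaleR_left_distrib[symmetric])
    qed
    have "2 *\<^sub>R (h * s) * 2 *\<^sub>R (h * s) = 4 *\<^sub>R (h * h * (1 - h * h))"
      using hhss s(2) by simp
    then show "a * a + 2 *\<^sub>R (h * s) * 2 *\<^sub>R (h * s) = 1 *\<^sub>R 1"
      unfolding aa by (simp add: right_diff_distrib scaleR_diff_right)
  qed
  then show ?thesis using abs_square_le_1[of "norm a"] by (simp add: a_def)
qed

text \<open>The inequality \<parallel>t 1 - x\<parallel> \<le> t is the norm form of positivity.
  Unlike being a square, it visibly survives sums, with the scalars \<open>t\<close> adding
  up.\<close>

lemma norm_scalar_minus_square:
  fixes h :: "'a::cstar_algebra"
  assumes "star h = h"
  shows "norm ((norm h)\<^sup>2 *\<^sub>R 1 - h * h) \<le> (norm h)\<^sup>2"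
proof (cases "h = 0")
  case False
  define g where "g = (1 / norm h) *\<^sub>R h"
  have g: "h = norm h *\<^sub>R g" "norm g = 1" "star g = g"
    using False by (simp_all add: g_def star_scaleR assms)
  have "h * h = (norm h)\<^sup>2 *\<^sub>R (g * g)"
    by (subst g(1), subst (2) g(1)) (simp add: power2_eq_square)
  then have "(norm h)\<^sup>2 *\<^sub>R 1 - h * h = (norm h)\<^sup>2 *\<^sub>R (1 - g * g)"
    by (simp add: scaleR_diff_right)
  then show ?thesis
    using norm_one_minus_square[of g] g(2,3) by (simp add: mult_left_le)
qed simp

section \<open>Inverses and Kaplansky's theorem\<close>

lemma one_minus_invertible:
  fixes g :: "'a::{real_normed_algebra_1, banach}"
  assumes "norm g < 1"
  obtains j where "j * (1 - g) = 1" "(1 - g) * j = 1"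
proof -
  have sm: "summable (\<lambda>n. g ^ n)"
    using assms by (rule complete_algebra_summable_geometric)
  define j where "j = (\<Sum>n. g ^ n)"
  have "j = 1 + (\<Sum>n. g ^ Suc n)"
    using suminf_split_head[OF sm] by (simp add: j_def algebra_simps)
  moreover have "(\<Sum>n. g ^ Suc n) = g * j" "(\<Sum>n. g ^ Suc n) = j * g"
    using suminf_mult[OF sm, of g] suminf_mult2[OF sm, of g]
    by (simp_all add: j_def power_commutes)
  ultimately have "j = 1 + g * j" "j = 1 + j * g" by simp_all
  then show ?thesis by (intro that[of j]) (simp_all add: algebra_simps)
qed

text \<open>Adding the norm forms of positivity gives \<parallel>T 1 - q\<parallel> \<le> T. Hence
  \<open>1 + q\<close> is \<open>1 + T\<close> times \<open>1 - g\<close> with \<open>g\<close> of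
  norm at most \<open>T / (1 + T)\<close>, and a Neumann series inverts it. The shape of
  \<open>q\<close> is the one that \<open>y * star y\<close> takes when
  \<open>star y * y = - (z * z)\<close>.\<close>

lemma sum_of_squares_plus_one_invertible:
  fixes z a b :: "'a::cstar_algebra"
  assumes sa: "star z = z" "star a = a" "star b = b"
  defines "q \<equiv> z * z + (1/2) *\<^sub>R (a * a + b * b)"
  obtains j where "j * (1 + q) = 1" "(1 + q) * j = 1"
proof -
  define T where "T = (norm z)\<^sup>2 + (norm a)\<^sup>2 / 2 + (norm b)\<^sup>2 / 2"
  have "T \<ge> 0" by (simp add: T_def)
  define u where "u = T *\<^sub>R 1 - q"
  define uz ua ub where "uz = (norm z)\<^sup>2 *\<^sub>R 1 - z * z" and "ua = (norm a)\<^sup>2 *\<^sub>R 1 - a * a"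
    and "ub = (norm b)\<^sup>2 *\<^sub>R 1 - b * b"
  have u: "u = uz + (1/2) *\<^sub>R (ua + ub)"
    by (simp add: u_def T_def q_def uz_def ua_def ub_def algebra_simps add_divide_distrib)
  have "norm uz \<le> (norm z)\<^sup>2" "norm ua \<le> (norm a)\<^sup>2" "norm ub \<le> (norm b)\<^sup>2"
    unfolding uz_def ua_def ub_def using sa by (simp_all only: norm_scalar_minus_square)
  moreover have "norm u \<le> norm uz + norm (ua + ub) / 2"
    using norm_triangle_ineq[of uz "(1/2) *\<^sub>R (ua + ub)"] by (simp add: u)
  ultimately have "norm u \<le> T"
    using norm_triangle_ineq[of ua ub] unfolding T_def by linarith
  define g where "g = (1 / (1 + T)) *\<^sub>R u"
  have "norm g < 1" using \<open>norm u \<le> T\<close> \<open>T \<ge> 0\<close> by (simp add: g_def)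
  then obtain j where j: "j * (1 - g) = 1" "(1 - g) * j = 1" by (rule one_minus_invertible)
  have "(1 + T) *\<^sub>R (1 - g) = 1 + q"
    using \<open>T \<ge> 0\<close> by (simp add: g_def scaleR_diff_right) (simp add: u_def algebra_simps)
  then show ?thesis
    using j \<open>T \<ge> 0\<close> by (intro that[of "(1 / (1 + T)) *\<^sub>R j"]) (simp_all flip: \<open>_ = 1 + q\<close>)
qed

lemma two_sided_inverse_commutes:
  fixes x :: "'a::ring_1"
  assumes "G * x = 1" "x * G = 1" "x * y = y * x"
  shows "G * y = y * G"
proof -
  have "G * y = G * (y * x) * G" using assms(2) by (simp add: mult.assoc)
  also have "\<dots> = G * x * y * G" by (simp add: assms(3)[symmetric] mult.assoc)
  finally show ?thesis by (simp add: assms(1))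
qed

text \<open>As \<open>1 + y y\<^sup>*\<close> is invertible, so is \<open>1 + y\<^sup>* y = 1 - z\<^sup>2\<close>. But if \<open>\<parallel>y\<parallel> = 1\<close>, then \<open>1\<close> is in the
  spectrum of \<open>z\<^sup>2\<close>.\<close>

lemma star_mult_eq_minus_square_normalized:
  fixes y z :: "'a::cstar_algebra"
  assumes z: "star z = z" and eq: "star y * y = - (z * z)"
  shows "norm y \<noteq> 1"
proof
  assume ny: "norm y = 1"
  \<comment> \<open>Up to sign, these are twice the real and imaginary parts of \<open>y\<close>.
    Hence \<open>a * a + b * b\<close> is twice \<open>y * star y + star y * y\<close>, and the
    hypothesis turns \<open>y * star y\<close> into a sum of squares.\<close>
  define a where "a = y + star y"
  define b where "b = \<i> *\<^sub>C (y - star y)"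
  have sa: "star a = a" "star b = b"
    by (simp_all add: a_def b_def star_add star_star star_scaleC star_diff add.commute
        complex_vs.scale_right_diff_distrib)
  have "b * b = - ((y - star y) * (y - star y))"
    by (simp add: b_def mult_scaleC_left mult_scaleC_right scaleC_scaleC)
  then have "a * a + b * b = 2 *\<^sub>R (y * star y) + 2 *\<^sub>R (star y * y)"
    by (simp add: a_def algebra_simps scaleR_2)
  then have q: "y * star y = z * z + (1/2) *\<^sub>R (a * a + b * b)"
    by (simp add: eq scaleR_diff_right)
  obtain j where j: "j * (1 + y * star y) = 1" "(1 + y * star y) * j = 1"
    using sum_of_squares_plus_one_invertible[OF z sa] unfolding q by blast
  \<comment> \<open>This is the identity behind the equality of the nonzero spectra of
    \<open>y * star y\<close> and \<open>star y * y\<close>; it makes \<open>G\<close> the inverse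
    of \<open>1 + star y * y\<close>.\<close>
  define G where "G = 1 - star y * j * y"
  define p where "p = z * z"
  have p: "1 - p = 1 + star y * y" by (simp add: p_def eq)
  have "G * (1 + star y * y) = 1 + star y * y - star y * (j * (1 + y * star y)) * y"
    by (simp add: G_def algebra_simps)
  then have G1: "G * (1 - p) = 1" by (simp add: p j)
  have "(1 + star y * y) * G = 1 + star y * y - star y * ((1 + y * star y) * j) * y"
    by (simp add: G_def algebra_simps)
  then have G2: "(1 - p) * G = 1" by (simp add: p j)
  have sp: "star p = p" by (simp add: p_def star_mult z)
  have sG: "star G = G"
  proof -
    have "star G * (1 - p) = star ((1 - p) * G)"
      by (simp only: star_mult star_diff star_one sp)
    then have "star G * (1 - p) = 1" by (simp add: G2 star_one)
    then show ?thesis by (metis G2 mult.assoc mult.left_neutral mult.right_neutral)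
  qed
  have zp: "p * z = z * p" by (simp add: p_def mult.assoc)
  have zG: "G * z = z * G"
    using G1 G2 by (rule two_sided_inverse_commutes) (simp add: algebra_simps zp)
  have pG: "p * G = G * p"
    using two_sided_inverse_commutes[OF G1 G2, of p] by (simp add: algebra_simps)
  \<comment> \<open>As \<open>(1 - p) * G = 1\<close>, the product of \<open>1 - p\<close> and
    \<open>1 - \<delta> *\<^sub>R G\<close> is \<open>1 - p - \<delta> *\<^sub>R 1\<close>. The
    choice of \<open>\<delta>\<close> puts \<open>\<delta> *\<^sub>R G\<close> in the unit ball, so
    both factors have self-adjoint square roots. Their product \<open>m\<close> satisfies
    \<open>z * z + m * m = (1 - \<delta>) *\<^sub>R 1\<close>, which forces the norm of
    \<open>z\<close> below 1.\<close>
  define \<delta> where "\<delta> = 1 / (1 + norm G)"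
  have \<delta>: "\<delta> > 0" "\<delta> \<le> 1" by (simp_all add: \<delta>_def add_pos_nonneg)
  have "norm (\<delta> *\<^sub>R G) \<le> 1" by (simp add: \<delta>_def divide_le_eq add_pos_nonneg)
  moreover have "star (\<delta> *\<^sub>R G) = \<delta> *\<^sub>R G" by (simp add: star_scaleR sG)
  ultimately obtain c where c: "star c = c" "norm c \<le> 1" "(1 - c) * (1 - c) = 1 - \<delta> *\<^sub>R G"
      "\<And>x. \<delta> *\<^sub>R G * x = x * \<delta> *\<^sub>R G \<Longrightarrow> c * x = x * c"
    by (rule sqrt_one_minus) blast
  have np: "norm p = 1"
    using cstar_identity[of y] ny by (simp add: p_def eq)
  then have "norm p \<le> 1" by simp
  then obtain d where d: "star d = d" "norm d \<le> 1" "(1 - d) * (1 - d) = 1 - p"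
      "\<And>x. p * x = x * p \<Longrightarrow> d * x = x * d"
    using sp by (rule sqrt_one_minus) blast
  have cz: "c * z = z * c" by (rule c(4)) (simp add: zG)
  have dz: "d * z = z * d" by (rule d(4)) (rule zp)
  have "c * p = p * c" by (rule c(4)) (simp add: pG)
  then have dc: "d * c = c * d" by (intro d(4)) simp
  define m where "m = (1 - d) * (1 - c)"
  have comm: "(1 - d) * (1 - c) = (1 - c) * (1 - d)"
    by (simp add: algebra_simps dc)
  have "star m = m" by (simp add: m_def star_mult star_diff star_one c d comm)
  moreover have "z * m = m * z"
  proof -
    have "z * (1 - d) = (1 - d) * z" "z * (1 - c) = (1 - c) * z"
      by (simp_all add: algebra_simps cz dz)
    then show ?thesis unfolding m_def by (metis mult.assoc)
  qed
  moreover have "z * z + m * m = (1 - \<delta>) *\<^sub>R 1"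
  proof -
    have "m * m = ((1 - d) * (1 - d)) * ((1 - c) * (1 - c))"
      unfolding m_def using comm by (metis mult.assoc)
    also have "\<dots> = (1 - p) - \<delta> *\<^sub>R ((1 - p) * G)"
      unfolding c(3) d(3) by (simp add: algebra_simps)
    also have "\<dots> = 1 - z * z - \<delta> *\<^sub>R 1" unfolding G2 by (simp add: p_def)
    finally show ?thesis by (simp add: algebra_simps)
  qed
  ultimately have "(norm z)\<^sup>2 \<le> \<bar>1 - \<delta>\<bar>"
    using z by (intro norm_le_sum_commuting_squares) auto
  moreover have "(norm z)\<^sup>2 = 1" using np norm_square_selfadjoint[OF z] by (simp add: p_def)
  ultimately show False using \<delta> by simp
qed

lemma star_mult_eq_minus_square_imp_zero:
  fixes y z :: "'a::cstar_algebra"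
  assumes z: "star z = z" and eq: "star y * y = - (z * z)"
  shows "y = 0"
proof (rule ccontr)
  assume "y \<noteq> 0"
  let ?r = "1 / norm y"
  have "norm (?r *\<^sub>R y) \<noteq> 1"
    by (rule star_mult_eq_minus_square_normalized[of "?r *\<^sub>R z"]) (simp_all add: star_scaleR z eq)
  with \<open>y \<noteq> 0\<close> show False by simp
qed

lemma nilpotent_selfadjoint:
  fixes v :: "'a::pre_cstar_algebra"
  assumes v: "star v = v" and "v * v * v = 0"
  shows "v = 0"
proof -
  have "star (v * v) * (v * v) = 0" using assms by (simp add: star_mult mult.assoc[symmetric])
  then have "v * v = 0" using cstar_identity[of "v * v"] by simp
  then show ?thesis using cstar_identity[of v] v by simp
qed

text \<open>Kaplansky's theorem. With \<open>h = x\<^sup>* x\<close>, \<open>r\<^sup>2 = \<bar>h\<bar>\<close> and twice the negative part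
  \<open>v = \<bar>h\<bar> - h\<close>, one gets \<open>(x v)\<^sup>* (x v) = - (v r)\<^sup>2\<close>.\<close>

lemma star_mult_self_normalized:
  fixes x :: "'a::cstar_algebra"
  assumes nx: "norm x \<le> 1"
  obtains r where "star r = r" "star x * x = r * r"
proof -
  define h where "h = star x * x"
  have sh: "star h = h" by (simp add: h_def star_mult star_star)
  have nh: "norm h \<le> 1" unfolding h_def cstar_identity using nx by (simp add: abs_square_le_1)
  \<comment> \<open>\<open>1 - c\<close> will be the absolute value of \<open>h\<close>, since its
    square is \<open>1 - (1 - h * h)\<close>; the bound brings \<open>1 - h * h\<close> within reach
    of the square root iteration.\<close>
  have "norm (1 - h * h) \<le> 1" by (rule norm_one_minus_square[OF nh sh])
  moreover have "star (1 - h * h) = 1 - h * h" by (simp add: star_diff star_one star_mult sh)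
  ultimately obtain c where c: "star c = c" "norm c \<le> 1" "(1 - c) * (1 - c) = 1 - (1 - h * h)"
      "\<And>x. (1 - h * h) * x = x * (1 - h * h) \<Longrightarrow> c * x = x * c"
    by (rule sqrt_one_minus) blast
  obtain d where d: "star d = d" "norm d \<le> 1" "(1 - d) * (1 - d) = 1 - c"
      "\<And>x. c * x = x * c \<Longrightarrow> d * x = x * d"
    using c(2,1) by (rule sqrt_one_minus) blast
  have ch: "c * h = h * c" by (rule c(4)) (simp add: algebra_simps)
  have dh: "d * h = h * d" by (rule d(4)) (rule ch)
  have dc: "d * c = c * d" by (rule d(4)) (rule refl)
  define r where "r = 1 - d"
  define n where "n = 1 - c"
  have sr: "star r = r" by (simp add: r_def star_diff star_one d)
  have rr: "r * r = n" by (simp add: r_def n_def d)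
  have nn: "n * n = h * h" by (simp add: n_def c)
  have nh: "n * h = h * n" by (simp add: n_def algebra_simps ch)
  define v where "v = n - h"
  have sv: "star v = v" by (simp add: v_def n_def star_diff star_one sh c)
  have rv: "r * v = v * r" by (simp add: r_def v_def n_def algebra_simps dc dh)
  \<comment> \<open>This is \<open>(n - h) * (n + h) = 0\<close>: next to \<open>v\<close>, the
    element \<open>h\<close> acts as minus its absolute value. Once \<open>x * v = 0\<close> is
    known, \<open>v * n * v\<close> and \<open>v * h * v\<close> both vanish, and their difference
    is \<open>v * v * v\<close>.\<close>
  have "v * h = - (v * n)" by (simp add: v_def algebra_simps nn nh)
  have "star (x * v) * (x * v) = v * h * v" by (simp add: star_mult sv h_def mult.assoc)
  also have "\<dots> = - (v * n * v)" using \<open>v * h = _\<close> by simp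
  also have "v * n * v = (v * r) * (v * r)" using rv rr by (metis mult.assoc)
  finally have e: "star (x * v) * (x * v) = - ((v * r) * (v * r))" .
  moreover have "star (v * r) = v * r" by (simp add: star_mult sv sr rv)
  ultimately have "x * v = 0" using star_mult_eq_minus_square_imp_zero by blast
  then have "v * n * v = 0" "v * h * v = 0"
    using \<open>v * n * v = _\<close> e \<open>star (x * v) * (x * v) = v * h * v\<close> by (simp_all add: star_zero)
  then have "v * v * v = 0"
    by (subst (2) v_def) (simp add: right_diff_distrib left_diff_distrib)
  then have "v = 0" using sv nilpotent_selfadjoint by blast
  then show ?thesis using sr rr by (intro that[of r]) (simp_all add: v_def h_def)
qed

text \<open>Kaplansky's theorem carries the bounds over from squares of self-adjoint elements. In
  this form positivity is visible to a functional dominated by the norm.\<close>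

lemma norm_one_minus_star_mult:
  fixes x :: "'a::cstar_algebra"
  assumes "norm x \<le> 1"
  shows "norm (1 - star x * x) \<le> 1" "norm (2 *\<^sub>R (star x * x) - 1) \<le> 1"
proof -
  obtain r where r: "star r = r" "star x * x = r * r" using star_mult_self_normalized[OF assms] .
  have "(norm r)\<^sup>2 = (norm x)\<^sup>2"
    using cstar_identity[of x] norm_square_selfadjoint[OF r(1)] r(2) by simp
  then have "norm r \<le> 1" using assms by simp
  then show "norm (1 - star x * x) \<le> 1" "norm (2 *\<^sub>R (star x * x) - 1) \<le> 1"
    using norm_one_minus_square norm_two_square_minus_one r by simp_all
qed

section \<open>Positive functionals\<close>

definition sublinear :: "('a::real_vector \<Rightarrow> real) \<Rightarrow> bool" where
  "sublinear p \<longleftrightarrow> (\<forall>x y. p (x + y) \<le> p x + p y) \<and> (\<forall>t\<ge>0. \<forall>x. p (t *\<^sub>R x) \<le> t * p x)"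

lemma
  assumes "sublinear p"
  shows sublinear_add: "p (x + y) \<le> p x + p y"
    and sublinear_scale_le: "t \<ge> 0 \<Longrightarrow> p (t *\<^sub>R x) \<le> t * p x"
    and sublinear_zero: "p 0 = 0"
    and sublinear_minus: "- p (- x) \<le> p x"
proof -
  have add: "p (x + y) \<le> p x + p y" for x y using assms unfolding sublinear_def by blast
  have scale: "p (t *\<^sub>R x) \<le> t * p x" if "t \<ge> 0" for t x
    using assms that unfolding sublinear_def by blast
  have zero: "p 0 = 0" using add[of 0 0] scale[of 0 0] by simp
  show "p (x + y) \<le> p x + p y" "t \<ge> 0 \<Longrightarrow> p (t *\<^sub>R x) \<le> t * p x" "p 0 = 0" "- p (- x) \<le> p x"
    using add scale zero add[of x "- x"] by simp_all
qed

text \<open>The definition asks only for an inequality, which is what infima inherit directly;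
  rescaling by \<open>1/t\<close> gives the converse.\<close>

lemma sublinear_scale:
  assumes "sublinear p" "t \<ge> 0"
  shows "p (t *\<^sub>R x) = t * p x"
proof (cases "t = 0")
  case False
  have "p ((1/t) *\<^sub>R t *\<^sub>R x) \<le> (1/t) * p (t *\<^sub>R x)"
    using assms by (intro sublinear_scale_le) auto
  then show ?thesis
    using sublinear_scale_le[OF assms, of x] assms(2) False by (simp add: field_simps)
qed (use assms in \<open>simp add: sublinear_zero\<close>)

text \<open>The infimum of \<open>p (x + t *\<^sub>R y) - t * p y\<close> over
  \<open>t \<ge> 0\<close> is again sublinear, and \<open>t = 1\<close> gives its bound at
  \<open>- y\<close>. It serves twice: to show that minimal functionals are odd, and to prescribe a
  value before Hahn-Banach is applied.\<close>

lemma sublinear_decrease: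
  assumes p: "sublinear p"
  obtains q where "sublinear q" "\<And>x. q x \<le> p x" "q (- y) \<le> - p y"
proof -
  define a where "a x t = p (x + t *\<^sub>R y) - t * p y" for x t
  define q where "q x = (INF t\<in>{0..}. a x t)" for x
  have lower: "- p (- x) \<le> a x t" if "t \<ge> 0" for x t
    using sublinear_add[OF p, of "x + t *\<^sub>R y" "- x"] sublinear_scale[OF p that, of y]
    by (simp add: a_def)
  then have "bdd_below (a x ` {0..})" for x by (intro bdd_belowI2[of _ "- p (- x)"]) auto
  then have le: "q x \<le> a x t" if "t \<ge> 0" for x t
    unfolding q_def using that by (intro cINF_lower) auto
  have ge: "c \<le> q x" if "\<And>t. t \<ge> 0 \<Longrightarrow> c \<le> a x t" for c x
    unfolding q_def by (rule cINF_greatest) (use that in auto)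
  have "q (x + x') \<le> q x + q x'" for x x'
  proof -
    have "q (x + x') - a x' s \<le> q x" if s: "s \<ge> 0" for s
    proof (rule ge)
      fix t :: real assume t: "t \<ge> 0"
      have "q (x + x') \<le> a (x + x') (t + s)" using s t by (intro le) simp
      also have "\<dots> \<le> a x t + a x' s"
        using sublinear_add[OF p, of "x + t *\<^sub>R y" "x' + s *\<^sub>R y"]
        by (simp add: a_def algebra_simps)
      finally show "q (x + x') - a x' s \<le> a x t" by simp
    qed
    then have "q (x + x') - q x \<le> q x'" by (intro ge) (simp add: algebra_simps)
    then show ?thesis by simp
  qed
  moreover have "q (c *\<^sub>R x) \<le> c * q x" if "c \<ge> 0" for c x
  proof (cases "c = 0")
    case True
    then show ?thesis using le[of 0 0] sublinear_zero[OF p] by (simp add: a_def)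
  next
    case False
    have "q (c *\<^sub>R x) / c \<le> q x"
    proof (rule ge)
      fix t :: real assume t: "t \<ge> 0"
      have "q (c *\<^sub>R x) \<le> a (c *\<^sub>R x) (c * t)" using that t by (intro le) simp
      also have "\<dots> = c * a x t"
        using sublinear_scale[OF p that, of "x + t *\<^sub>R y"] by (simp add: a_def algebra_simps)
      finally show "q (c *\<^sub>R x) / c \<le> a x t" using that False by (simp add: field_simps)
    qed
    then show ?thesis using that False by (simp add: field_simps)
  qed
  ultimately have "sublinear q" unfolding sublinear_def by blast
  moreover have "q x \<le> p x" for x using le[of 0 x] by (simp add: a_def)
  moreover have "q (- y) \<le> - p y" using le[of 1 "- y"] sublinear_zero[OF p] by (simp add: a_def)
  ultimately show ?thesis by (rule that)
qed

text \<open>Subadditivity uses the chain: \<open>x\<close> and \<open>y\<close> may call for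
  different members, and the smaller of the two serves both. The common majorant \<open>p\<close>
  supplies the lower bound \<open>- p (- x)\<close> that keeps the infima finite.\<close>

lemma sublinear_INF:
  assumes C: "C \<noteq> {}" "\<And>q. q \<in> C \<Longrightarrow> sublinear q" "\<And>q x. q \<in> C \<Longrightarrow> q x \<le> p x"
    and chain: "\<And>q q'. q \<in> C \<Longrightarrow> q' \<in> C \<Longrightarrow> (\<forall>x. q x \<le> q' x) \<or> (\<forall>x. q' x \<le> q x)"
  obtains u where "sublinear u" "\<And>q x. q \<in> C \<Longrightarrow> u x \<le> q x"
proof -
  define u where "u x = (INF q\<in>C. q x)" for x
  have "- p (- x) \<le> q x" if "q \<in> C" for q x
    using C(3)[OF that, of "- x"] sublinear_minus[OF C(2)[OF that], of x] by linarith
  then have "bdd_below ((\<lambda>q. q x) ` C)" for x by (intro bdd_belowI2[of _ "- p (- x)"])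
  then have le: "u x \<le> q x" if "q \<in> C" for q x
    unfolding u_def using that by (intro cINF_lower) auto
  have ge: "c \<le> u x" if "\<And>q. q \<in> C \<Longrightarrow> c \<le> q x" for c x
    unfolding u_def by (rule cINF_greatest) (use that C(1) in auto)
  have "u (x + y) \<le> u x + u y" for x y
  proof -
    have "u (x + y) - q' y \<le> u x" if q': "q' \<in> C" for q'
    proof (rule ge)
      fix q assume q: "q \<in> C"
      obtain r where r: "r \<in> C" "r x \<le> q x" "r y \<le> q' y"
        using chain[OF q q'] q q' by (metis order_refl)
      have "u (x + y) \<le> r x + r y"
        using le[OF r(1)] sublinear_add[OF C(2)[OF r(1)]] by (meson order.trans)
      then show "u (x + y) - q' y \<le> q x" using r by linarith
    qed
    then have "u (x + y) - u x \<le> u y" by (intro ge) (simp add: algebra_simps)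
    then show ?thesis by simp
  qed
  moreover have "u (c *\<^sub>R x) \<le> c * u x" if "c \<ge> 0" for c x
  proof (cases "c = 0")
    case True
    obtain q where "q \<in> C" using C(1) by blast
    then show ?thesis using le[of q 0] sublinear_zero[OF C(2)[of q]] True by simp
  next
    case False
    have "u (c *\<^sub>R x) / c \<le> u x"
    proof (rule ge)
      fix q assume q: "q \<in> C"
      have "u (c *\<^sub>R x) \<le> c * q x"
        using le[OF q, of "c *\<^sub>R x"] sublinear_scale[OF C(2)[OF q] that, of x] by simp
      then show "u (c *\<^sub>R x) / c \<le> q x" using that False by (simp add: field_simps)
    qed
    then show ?thesis using that False by (simp add: field_simps)
  qed
  ultimately have "sublinear u" unfolding sublinear_def by blast
  then show ?thesis using le by (rule that)
qed

text \<open>The Hahn--Banach theorem: a minimal sublinear functional is linear.\<close>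

lemma linear_below_sublinear:
  fixes p :: "'a::real_vector \<Rightarrow> real"
  assumes p: "sublinear p"
  obtains f where "linear f" "\<And>x. f x \<le> p x"
proof -
  define A where "A = {q. sublinear q \<and> (\<forall>x. q x \<le> p x)}"
  \<comment> \<open>The order is reversed, so that a maximal element in Zorn's lemma is a pointwise
    minimal functional.\<close>
  define P where "P q q' \<longleftrightarrow> (\<forall>x. q' x \<le> q x)" for q q' :: "'a \<Rightarrow> real"
  have "\<exists>m\<in>A. \<forall>q\<in>A. P m q \<longrightarrow> q = m"
  proof (rule predicate_Zorn)
    show "partial_order_on A (relation_of P A)"
      unfolding partial_order_on_def preorder_on_def refl_on_def trans_def antisym_def
        relation_of_def P_def
      by (auto intro: order.trans intro!: ext order.antisym)
  next
    fix C assume ch: "C \<in> Chains (relation_of P A)"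
    then have CA: "C \<subseteq> A" unfolding Chains_def relation_of_def by blast
    show "\<exists>u\<in>A. \<forall>q\<in>C. P q u"
    proof (cases "C = {}")
      case True
      then show ?thesis using p by (auto simp: A_def)
    next
      case False
      have cmp: "(\<forall>x. q x \<le> q' x) \<or> (\<forall>x. q' x \<le> q x)" if "q \<in> C" "q' \<in> C" for q q'
        using ch that unfolding Chains_def relation_of_def P_def by blast
      have CA': "sublinear q" "q x \<le> p x" if "q \<in> C" for q x
        using CA that by (auto simp: A_def)
      obtain u where u: "sublinear u" "\<And>q x. q \<in> C \<Longrightarrow> u x \<le> q x"
        by (rule sublinear_INF[of C p]) (use False CA' cmp in blast)+
      obtain q where "q \<in> C" using False by blast
      then have "u x \<le> p x" for x using u(2) CA'(2) by (meson order.trans)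
      then have "u \<in> A" using u(1) by (simp add: A_def)
      then show ?thesis using u(2) by (auto simp: P_def)
    qed
  qed
  then obtain m where mA: "m \<in> A" and min: "\<And>q. q \<in> A \<Longrightarrow> (\<forall>x. q x \<le> m x) \<Longrightarrow> q = m"
    unfolding P_def by blast
  have m: "sublinear m" and mp: "m x \<le> p x" for x using mA by (auto simp: A_def)
  \<comment> \<open>Lowering \<open>m\<close> in the direction \<open>- y\<close> cannot change it,
    by minimality; so \<open>m\<close> is odd, and an odd sublinear functional is linear.\<close>
  have neg: "m (- y) = - m y" for y
  proof -
    obtain q where q: "sublinear q" "\<And>x. q x \<le> m x" "q (- y) \<le> - m y"
      using sublinear_decrease[OF m] by blast
    then have "q \<in> A" using mp by (auto simp: A_def intro: order.trans)
    then have "q = m" using q(2) by (intro min) auto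
    then show ?thesis using q(3) sublinear_minus[OF m, of "- y"] by simp
  qed
  have "linear m"
  proof (rule linearI)
    show "m (x + y) = m x + m y" for x y
      using sublinear_add[OF m, of x y] sublinear_add[OF m, of "- x" "- y"] neg[of "x + y"] neg
      by simp
    show "m (t *\<^sub>R x) = t *\<^sub>R m x" for t x
      using sublinear_scale[OF m, of t x] sublinear_scale[OF m, of "- t" x] neg[of "t *\<^sub>R x"]
      by (cases "t \<ge> 0") auto
  qed
  then show ?thesis using mp by (rule that)
qed

text \<open>The norm is first lowered in the direction \<open>- y\<close>. Every linear functional
  below the result satisfies \<open>f (- y) \<le> - norm y\<close> and thus attains the norm at
  \<open>y\<close>.\<close>

lemma norming_functional:
  fixes y :: "'a::real_normed_vector"
  obtains f where "linear f" "\<And>x. f x \<le> norm x" "f y = norm y"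
proof -
  have "sublinear (norm :: 'a \<Rightarrow> real)"
    by (simp add: sublinear_def norm_triangle_ineq)
  then obtain q where q: "sublinear q" "\<And>x. q x \<le> norm x" "q (- y) \<le> - norm y"
    using sublinear_decrease[of norm y] by blast
  obtain f where f: "linear f" "\<And>x. f x \<le> q x"
    using linear_below_sublinear[OF q(1)] by blast
  have "f x \<le> norm x" for x using f(2) q(2) by (rule order.trans)
  moreover from this[of y] have "f y = norm y"
    using f(2)[of "- y"] q(3) linear_neg[OF f(1), of y] by simp
  ultimately show ?thesis using f(1) by (intro that[of f])
qed

section \<open>Positive functionals from norm bounds\<close>

definition positive_functional :: "('a::pre_cstar_algebra \<Rightarrow> complex) \<Rightarrow> bool" where
  "positive_functional F \<longleftrightarrow>
     (\<forall>x y. F (x + y) = F x + F y) \<and> (\<forall>c x. F (c *\<^sub>C x) = c * F x) \<and>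
     (\<forall>x. F (star x) = cnj (F x)) \<and> (\<forall>x. 0 \<le> Re (F (star x * x)))"

lemma
  assumes "positive_functional F"
  shows positive_functional_add: "F (x + y) = F x + F y"
    and positive_functional_scale: "F (c *\<^sub>C x) = c * F x"
    and positive_functional_star: "F (star x) = cnj (F x)"
    and positive_functional_nonneg: "0 \<le> Re (F (star x * x))"
  using assms unfolding positive_functional_def by blast+

text \<open>Averaging over the involution makes the functional hermitian and keeps its values on the
  self-adjoint elements \<open>star x * x\<close>; \<open>F\<close> is then the complex-linear
  functional with real part \<open>g\<close>.\<close>

lemma complexified_positive_functional:
  fixes f :: "'a::pre_cstar_algebra \<Rightarrow> real"
  assumes f: "linear f" and pos: "\<And>x. 0 \<le> f (star x * x)"
  obtains F where "positive_functional F" "\<And>x. Re (F (star x * x)) = f (star x * x)"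
proof -
  define g where "g x = (f x + f (star x)) / 2" for x
  define F where "F x = Complex (g x) (- g (\<i> *\<^sub>C x))" for x
  have g_add: "g (x + y) = g x + g y" for x y
    by (simp add: g_def star_add linear_add[OF f] add_divide_distrib)
  have g_scale: "g (r *\<^sub>R x) = r * g x" for r x
    by (simp add: g_def star_scaleR linear_scale[OF f] algebra_simps)
  have g_star: "g (star x) = g x" for x by (simp add: g_def star_star)
  have g_minus: "g (- x) = - g x" for x using g_scale[of "-1" x] by simp
  have F_add: "F (x + y) = F x + F y" for x y
    by (simp add: F_def g_add scaleC_add_right complex_eq_iff)
  have F_i: "F (\<i> *\<^sub>C x) = \<i> * F x" for x
    by (simp add: F_def scaleC_scaleC g_minus complex_eq_iff)
  have F_r: "F (r *\<^sub>R x) = complex_of_real r * F x" for r x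
  proof -
    have "\<i> *\<^sub>C r *\<^sub>R x = r *\<^sub>R \<i> *\<^sub>C x"
      by (simp add: scaleR_eq_scaleC scaleC_scaleC mult.commute)
    then show ?thesis by (simp add: F_def g_scale complex_eq_iff)
  qed
  have "F (c *\<^sub>C x) = c * F x" for c x
  proof -
    have "c *\<^sub>C x = Re c *\<^sub>R x + Im c *\<^sub>R \<i> *\<^sub>C x"
      by (simp add: scaleR_eq_scaleC scaleC_scaleC scaleC_add_left[symmetric] complex_eq_iff)
    then have "F (c *\<^sub>C x) = (complex_of_real (Re c) + \<i> * complex_of_real (Im c)) * F x"
      by (simp add: F_add F_r F_i algebra_simps)
    then show ?thesis by (simp add: complex_eq[symmetric])
  qed
  moreover have "F (star x) = cnj (F x)" for x
  proof -
    have "\<i> *\<^sub>C star x = star (- (\<i> *\<^sub>C x))" by (simp add: star_minus star_scaleC)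
    then show ?thesis by (simp add: F_def g_star g_minus complex_eq_iff)
  qed
  moreover have "Re (F (star x * x)) = f (star x * x)" for x
    by (simp add: F_def g_def star_mult star_star)
  ultimately show ?thesis using pos F_add by (intro that[of F]) (auto simp: positive_functional_def)
qed

text \<open>A functional below the norm with value 1 at \<open>star w' * w'\<close> takes the value
  \<open>2 - f 1\<close> at \<open>2 *\<^sub>R (star w' * w') - 1\<close>, an element of the unit
  ball; so \<open>f 1 \<ge> 1\<close>. Then \<open>f (1 - star x' * x') \<le> 1\<close> leaves
  \<open>f (star x' * x') \<ge> f 1 - 1 \<ge> 0\<close>.\<close>

lemma ex_positive_functional:
  fixes w :: "'a::cstar_algebra"
  assumes "w \<noteq> 0"
  obtains F where "positive_functional F" "Re (F (star w * w)) > 0"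
proof -
  define w' where "w' = (1 / norm w) *\<^sub>R w"
  have nw': "norm w' = 1" using assms by (simp add: w'_def)
  have w: "star w * w = (norm w)\<^sup>2 *\<^sub>R (star w' * w')"
    using assms by (simp add: w'_def star_scaleR power2_eq_square)
  obtain f where f: "linear f" "\<And>x. f x \<le> norm x" "f (star w' * w') = norm (star w' * w')"
    using norming_functional by blast
  have fw': "f (star w' * w') = 1" by (simp add: f(3) cstar_identity nw')
  have "norm (2 *\<^sub>R (star w' * w') - 1) \<le> 1" using nw' by (intro norm_one_minus_star_mult) simp
  then have "f (2 *\<^sub>R (star w' * w') - 1) \<le> 1" using f(2) order.trans by blast
  then have f1: "f 1 \<ge> 1" by (simp add: linear_diff[OF f(1)] linear_scale[OF f(1)] fw')
  have "0 \<le> f (star x * x)" for x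
  proof (cases "x = 0")
    case False
    define x' where "x' = (1 / norm x) *\<^sub>R x"
    have "norm x' \<le> 1" using False by (simp add: x'_def)
    then have "norm (1 - star x' * x') \<le> 1" by (rule norm_one_minus_star_mult)
    then have "f (1 - star x' * x') \<le> 1" using f(2) order.trans by blast
    then have "f (star x' * x') \<ge> 0" using f1 by (simp add: linear_diff[OF f(1)])
    moreover have "star x * x = (norm x)\<^sup>2 *\<^sub>R (star x' * x')"
      using False by (simp add: x'_def star_scaleR power2_eq_square)
    ultimately show ?thesis by (simp add: linear_scale[OF f(1)])
  qed (simp add: linear_0[OF f(1)])
  then obtain F where F: "positive_functional F" "\<And>x. Re (F (star x * x)) = f (star x * x)"
    using complexified_positive_functional[OF f(1)] by blast
  moreover have "f (star w * w) > 0" using assms by (simp add: w linear_scale[OF f(1)] fw')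
  ultimately show ?thesis by (intro that[of F]) simp_all
qed

section \<open>Semi-inner products\<close>

text \<open>Null vectors are allowed, so that the algebra itself can stand for the GNS space. The
  form is used on the completion, on the dense algebra through its embedding, and on coefficient
  functions of a positive semidefinite matrix.\<close>

locale semi_inner = vector_space scale
  for scale :: "complex \<Rightarrow> 'v::ab_group_add \<Rightarrow> 'v"  (infixr "*s" 75) +
  fixes s :: "'v \<Rightarrow> 'v \<Rightarrow> complex"
  assumes add_right: "s x (y + z) = s x y + s x z"
    and scale_right: "s x (c *s y) = c * s x y"
    and hermitian: "s y x = cnj (s x y)"
    and nonneg: "0 \<le> Re (s x x)"
begin

definition nsq :: "'v \<Rightarrow> real" where
  "nsq x = Re (s x x)"

lemma nsq_nonneg: "0 \<le> nsq x"
  by (simp add: nsq_def nonneg)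

lemma s_self: "s x x = complex_of_real (nsq x)"
  using hermitian[of x x] by (simp add: nsq_def complex_eq_iff)

lemma add_left: "s (x + y) z = s x z + s y z"
  by (metis add_right complex_cnj_add hermitian)

lemma scale_left: "s (c *s x) y = cnj c * s x y"
  by (metis complex_cnj_mult hermitian scale_right)

lemma zero_right: "s x 0 = 0"
  using add_right[of x 0 0] by simp

lemma minus_right: "s x (- y) = - s x y"
  using add_right[of x y "- y"] zero_right by (simp add: eq_neg_iff_add_eq_0 add.commute)

lemma diff_right: "s x (y - z) = s x y - s x z"
  using add_right[of x y "- z"] by (simp add: minus_right)

lemma diff_left: "s (x - y) z = s x z - s y z"
  by (metis diff_right complex_cnj_diff hermitian)

lemma sum_right: "s x (\<Sum>i\<in>I. f i) = (\<Sum>i\<in>I. s x (f i))"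
  by (induction I rule: infinite_finite_induct) (simp_all add: zero_right add_right)

text \<open>The parallelogram law gives a triangle inequality for squared lengths, at the cost of a
  factor 2.\<close>

lemma nsq_add_le: "nsq (x + y) \<le> 2 * nsq x + 2 * nsq y"
proof -
  have "nsq (x + y) + nsq (x - y) = 2 * nsq x + 2 * nsq y"
    by (simp add: nsq_def add_left add_right diff_left diff_right)
  then show ?thesis using nsq_nonneg[of "x - y"] by linarith
qed

lemma nsq_scale: "nsq (c *s x) = (cmod c)\<^sup>2 * nsq x"
proof -
  have "s (c *s x) (c *s x) = (c * cnj c) * s x x"
    by (simp add: scale_left scale_right)
  then show ?thesis by (simp add: nsq_def complex_norm_square[symmetric] flip: of_real_power)
qed

lemma nsq_eq_0_imp_orthogonal:
  assumes x: "nsq x = 0"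
  shows "s x y = 0"
proof (rule ccontr)
  assume "s x y \<noteq> 0"
  define r where "r = (cmod (s x y))\<^sup>2"
  have "r > 0" using \<open>s x y \<noteq> 0\<close> by (simp add: r_def)
  \<comment> \<open>Moving \<open>y\<close> along the null vector \<open>x\<close> lowers its
    squared length linearly and without bound; this \<open>t\<close> makes it equal to -1.\<close>
  define t where "t = (nsq y + 1) / (2 * r)"
  define z where "z = y - (complex_of_real t * s x y) *s x"
  have xx: "s x x = 0" using s_self[of x] x by simp
  have r: "s x y * cnj (s x y) = complex_of_real r"
    by (simp add: r_def complex_norm_square[symmetric] del: of_real_power)
  have "s z z = s y y - complex_of_real t * (s x y * s y x) - complex_of_real t * (cnj (s x y) * s x y)"
    by (simp add: z_def diff_left diff_right scale_left scale_right xx)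
  also have "\<dots> = complex_of_real (nsq y - 2 * t * r)"
    using r hermitian[of y x] by (simp add: s_self mult.commute)
  finally have "nsq z = nsq y - 2 * t * r" by (simp add: nsq_def)
  also have "\<dots> = -1" using \<open>r > 0\<close> by (simp add: t_def field_simps)
  finally show False using nsq_nonneg[of z] by simp
qed

section \<open>Orthonormal families and Gram-Schmidt\<close>

definition orthonormal :: "'v set \<Rightarrow> bool" where
  "orthonormal G \<longleftrightarrow> finite G \<and> (\<forall>g\<in>G. \<forall>h\<in>G. s g h = (if g = h then 1 else 0))"

definition residual :: "'v set \<Rightarrow> 'v \<Rightarrow> 'v" where
  "residual G x = x - (\<Sum>g\<in>G. s g x *s g)"

lemma residual_orthogonal:
  assumes G: "orthonormal G" and g: "g \<in> G"
  shows "s g (residual G x) = 0"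
proof -
  have "(\<Sum>h\<in>G. s h x * s g h) = (\<Sum>h\<in>G. if g = h then s h x else 0)"
    using G g by (intro sum.cong) (auto simp: orthonormal_def)
  also have "\<dots> = s g x" using G g by (simp add: orthonormal_def)
  finally show ?thesis by (simp add: residual_def diff_right sum_right scale_right)
qed

lemma orthonormal_expansion:
  assumes G: "orthonormal G"
  shows "s x y = s (residual G x) (residual G y) + (\<Sum>g\<in>G. cnj (s g x) * s g y)"
proof -
  have y: "y = residual G y + (\<Sum>g\<in>G. s g y *s g)" by (simp add: residual_def)
  have "s x (\<Sum>g\<in>G. s g y *s g) = (\<Sum>g\<in>G. cnj (s g x) * s g y)"
    by (simp add: sum_right scale_right hermitian[of x] mult.commute)
  moreover have "s x (residual G y) = s (residual G x) (residual G y)"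
  proof -
    have "s (residual G y) (\<Sum>g\<in>G. s g x *s g) = 0"
      using residual_orthogonal[OF G, of _ y]
      by (simp add: sum_right scale_right hermitian[of "residual G y"])
    then have "s (\<Sum>g\<in>G. s g x *s g) (residual G y) = 0"
      by (subst hermitian) simp
    then show ?thesis unfolding residual_def[of G x] by (simp add: diff_left)
  qed
  ultimately show ?thesis using add_right[of x "residual G y" "\<Sum>g\<in>G. s g y *s g"] y by simp
qed

lemma pythagoras:
  assumes "orthonormal G"
  shows "nsq x = nsq (residual G x) + (\<Sum>g\<in>G. (cmod (s g x))\<^sup>2)"
proof -
  have "complex_of_real (nsq x) =
      complex_of_real (nsq (residual G x)) + (\<Sum>g\<in>G. complex_of_real ((cmod (s g x))\<^sup>2))"
    using orthonormal_expansion[OF assms, of x x]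
    by (simp add: s_self complex_norm_square mult.commute del: of_real_power)
  then have "complex_of_real (nsq x) =
      complex_of_real (nsq (residual G x) + (\<Sum>g\<in>G. (cmod (s g x))\<^sup>2))" by simp
  then show ?thesis by (simp only: of_real_eq_iff)
qed

lemma bessel:
  assumes "orthonormal G"
  shows "(\<Sum>g\<in>G. (cmod (s g x))\<^sup>2) \<le> nsq x"
  using pythagoras[OF assms, of x] nsq_nonneg[of "residual G x"] by linarith

lemma nsq_residual_le:
  assumes "orthonormal G"
  shows "nsq (residual G x) \<le> nsq x"
  using pythagoras[OF assms, of x] sum_nonneg[of G "\<lambda>g. (cmod (s g x))\<^sup>2"] by simp

lemma residual_add: "residual G (x + y) = residual G x + residual G y"
  by (simp add: residual_def add_right scale_left_distrib sum.distrib)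

text \<open>When the residual for \<open>G'\<close> is null, the residual for \<open>G\<close> is
  measured by the new vectors \<open>G' - G\<close> alone. This is how a bound on a dimension
  becomes a bound on a norm.\<close>

lemma nsq_residual_mono:
  assumes "orthonormal G'" "G \<subseteq> G'"
  shows "nsq (residual G' x) + (\<Sum>g\<in>G' - G. (cmod (s g x))\<^sup>2) = nsq (residual G x)"
proof -
  have "finite G'" "orthonormal G"
    using assms unfolding orthonormal_def by (meson finite_subset subsetD)+
  then show ?thesis
    using pythagoras[OF assms(1), of x] pythagoras[of G x]
      sum.subset_diff[OF assms(2), of "\<lambda>g. (cmod (s g x))\<^sup>2"] by simp
qed

lemma orthonormal_independent:
  assumes G: "orthonormal G"
  shows "independent G"
proof (rule independent_if_scalars_zero)
  show "finite G" using G by (simp add: orthonormal_def)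
next
  fix f g assume f: "(\<Sum>x\<in>G. f x *s x) = 0" and g: "g \<in> G"
  have "(\<Sum>x\<in>G. f x * s g x) = s g (\<Sum>x\<in>G. f x *s x)" by (simp add: sum_right scale_right)
  also have "\<dots> = 0" by (simp add: f zero_right)
  also have "(\<Sum>x\<in>G. f x * s g x) = (\<Sum>x\<in>G. if g = x then f x else 0)"
    using G g by (intro sum.cong) (auto simp: orthonormal_def)
  also have "\<dots> = f g" using G g by (simp add: orthonormal_def)
  finally show "f g = 0" .
qed

text \<open>A residual of length zero cannot be normalized, and then \<open>G\<close> stays as it
  is. Hence the conclusion is a null residual and not membership of \<open>e\<close> in a
  span.\<close>

lemma gram_schmidt_step:
  assumes G: "orthonormal G"
  obtains G' where "orthonormal G'" "G \<subseteq> G'" "G' \<subseteq> span (insert e G)" "nsq (residual G' e) = 0"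
proof (cases "nsq (residual G e) = 0")
  case True
  then show ?thesis using G by (intro that[of G]) (auto intro: span_base)
next
  case False
  define r where "r = residual G e"
  define n where "n = nsq r"
  have n: "n > 0" using False nsq_nonneg[of r] by (simp add: n_def r_def)
  define g where "g = complex_of_real (1 / sqrt n) *s r"
  have orth: "s h g = 0" "s g h = 0" if "h \<in> G" for h
    using residual_orthogonal[OF G that, of e] hermitian[of g h]
    by (simp_all add: g_def r_def scale_right)
  have "nsq g = 1" using n by (simp add: g_def nsq_scale n_def[symmetric] power_divide norm_divide)
  then have gg: "s g g = 1" by (simp add: s_self)
  have "g \<notin> G" using orth[of g] gg by auto
  have G': "orthonormal (insert g G)"
    using G orth gg \<open>g \<notin> G\<close> by (auto simp: orthonormal_def)
  have "r \<in> span (insert e G)"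
    unfolding r_def residual_def
    by (intro span_diff span_sum span_scale span_base) auto
  then have "g \<in> span (insert e G)" unfolding g_def by (rule span_scale)
  moreover have "nsq (residual (insert g G) e) = 0"
  proof -
    have "s r e = complex_of_real n"
    proof -
      have "s h r = 0" if "h \<in> G" for h
        using residual_orthogonal[OF G that, of e] by (simp add: r_def)
      moreover from this have "residual G r = r" by (simp add: residual_def[of G r])
      ultimately show ?thesis
        using orthonormal_expansion[OF G, of r e] by (simp add: r_def[symmetric] s_self n_def)
    qed
    then have "s g e = complex_of_real (n / sqrt n)" by (simp add: g_def scale_left)
    then have "(cmod (s g e))\<^sup>2 = n" using n by (simp only: norm_of_real) (simp add: power_divide power2_eq_square)
    moreover have "insert g G - G = {g}" using \<open>g \<notin> G\<close> by auto
    ultimately show ?thesis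
      using nsq_residual_mono[OF G', of G e] by (simp add: subset_insertI n_def r_def)
  qed
  ultimately show ?thesis
    using G' by (intro that[of "insert g G"]) (auto intro: span_base)
qed

text \<open>\<open>G\<close> is extended, not replaced: an orthonormal basis of \<open>W\<close>
  will be enlarged to account for \<open>b W + W\<close>. Earlier elements keep null residuals,
  because a larger family has shorter residuals.\<close>

lemma gram_schmidt:
  assumes "finite E" "orthonormal G"
  shows "\<exists>G'. orthonormal G' \<and> G \<subseteq> G' \<and> G' \<subseteq> span (E \<union> G) \<and> (\<forall>e\<in>E. nsq (residual G' e) = 0)"
  using assms(1)
proof (induction E rule: finite_induct)
  case empty
  then show ?case using assms(2) by (auto intro: span_base)
next
  case (insert e E)
  then obtain H where H: "orthonormal H" "G \<subseteq> H" "H \<subseteq> span (E \<union> G)" "\<forall>e\<in>E. nsq (residual H e) = 0"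
    by blast
  obtain G' where G': "orthonormal G'" "H \<subseteq> G'" "G' \<subseteq> span (insert e H)" "nsq (residual G' e) = 0"
    using gram_schmidt_step[OF H(1)] by blast
  have "H \<subseteq> span (insert e E \<union> G)"
    using H(3) span_mono[of "E \<union> G" "insert e E \<union> G"] by auto
  then have "span (insert e H) \<subseteq> span (insert e E \<union> G)"
    by (intro span_minimal) (auto intro: span_base)
  moreover have "nsq (residual G' x) = 0" if "x \<in> E" for x
  proof -
    have "nsq (residual G' x) \<le> nsq (residual H x)"
      using nsq_residual_mono[OF G'(1,2), of x] sum_nonneg[of "G' - H" "\<lambda>g. (cmod (s g x))\<^sup>2"] by simp
    then show ?thesis using H(4) that nsq_nonneg[of "residual G' x"] by simp
  qed
  ultimately show ?case using G' H(2) by (intro exI[of _ G']) auto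
qed

end

text \<open>\<open>M\<close> is the Gram matrix of the coordinate vectors for the form that it
  defines; their coefficients in a Gram-Schmidt family are the columns of \<open>Z\<close>.\<close>

lemma positive_semidefinite_factorization:
  fixes M :: "nat \<Rightarrow> nat \<Rightarrow> complex"
  assumes herm: "\<And>i j. i < N \<Longrightarrow> j < N \<Longrightarrow> M j i = cnj (M i j)"
    and pos: "\<And>c. 0 \<le> Re (\<Sum>i<N. \<Sum>j<N. cnj (c i) * M i j * c j)"
  shows "\<exists>Z. \<forall>i<N. \<forall>j<N. M i j = (\<Sum>l<N. cnj (Z l i) * Z l j)"
proof -
  define t where "t c d = (\<Sum>i<N. \<Sum>j<N. cnj (c i) * M i j * d j)" for c d :: "nat \<Rightarrow> complex"
  interpret V: semi_inner "\<lambda>a (c::nat \<Rightarrow> complex) i. a * c i" t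
  proof
    fix a b :: complex and x y z :: "nat \<Rightarrow> complex"
    show "(\<lambda>i. a * (x + y) i) = (\<lambda>i. a * x i) + (\<lambda>i. a * y i)"
      "(\<lambda>i. (a + b) * x i) = (\<lambda>i. a * x i) + (\<lambda>i. b * x i)"
      "(\<lambda>i. a * (b * x i)) = (\<lambda>i. a * b * x i)" "(\<lambda>i. 1 * x i) = x"
      by (auto simp: algebra_simps)
    show "t x (y + z) = t x y + t x z" by (simp add: t_def algebra_simps sum.distrib)
    show "t x (\<lambda>i. a * y i) = a * t x y"
      by (simp add: t_def sum_distrib_left algebra_simps)
    have "cnj (t x y) = (\<Sum>i<N. \<Sum>j<N. x i * M j i * cnj (y j))"
      unfolding t_def using herm by (simp add: herm[symmetric])
    also have "\<dots> = t y x" unfolding t_def by (subst sum.swap) (simp add: algebra_simps)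
    finally show "t y x = cnj (t x y)" by simp
    show "0 \<le> Re (t x x)" unfolding t_def by (rule pos)
  qed
  define u where "u i = (\<lambda>j. if j = i then 1 else 0 :: complex)" for i :: nat
  have "t (u i) (u j) = M i j" if "i < N" "j < N" for i j
  proof -
    have "t (u i) (u j) = (\<Sum>i'<N. \<Sum>j'<N. if j' = j then if i' = i then M i' j' else 0 else 0)"
      unfolding t_def u_def by (intro sum.cong) auto
    then show ?thesis using that by simp
  qed
  note t_u = this
  have "finite (u ` {..<N})" "V.orthonormal {}" by (simp_all add: V.orthonormal_def)
  then obtain G where G: "V.orthonormal G" "G \<subseteq> V.span (u ` {..<N} \<union> {})"
      "\<forall>e\<in>u ` {..<N}. V.nsq (V.residual G e) = 0"
    using V.gram_schmidt by blast
  have "finite G" using G(1) by (simp add: V.orthonormal_def)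
  have "card G \<le> card (u ` {..<N})"
    using V.independent_span_bound[OF _ V.orthonormal_independent[OF G(1)], of "u ` {..<N}"] G(2)
    by simp
  also have "\<dots> \<le> N" using card_image_le[of "{..<N}" u] by simp
  finally have "card G \<le> N" .
  obtain h where h: "bij_betw h {..<card G} G"
    using \<open>finite G\<close> ex_bij_betw_nat_finite[of G] by (auto simp: atLeast0LessThan)
  \<comment> \<open>A degenerate \<open>M\<close> yields fewer than \<open>N\<close> orthonormal
    vectors; zero rows fill the factor up to the square shape that \<open>mat_positive\<close>
    demands.\<close>
  define Z where "Z l i = (if l < card G then t (h l) (u i) else 0)" for l i
  have "M i j = (\<Sum>l<N. cnj (Z l i) * Z l j)" if "i < N" "j < N" for i j
  proof -
    have "M i j = (\<Sum>g\<in>G. cnj (t g (u i)) * t g (u j))"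
      using V.orthonormal_expansion[OF G(1), of "u i" "u j"] that G(3)
        V.nsq_eq_0_imp_orthogonal[of "V.residual G (u i)"] by (simp add: t_u)
    also have "\<dots> = (\<Sum>l<card G. cnj (t (h l) (u i)) * t (h l) (u j))"
      using sum.reindex_bij_betw[OF h, of "\<lambda>g. cnj (t g (u i)) * t g (u j)"] by simp
    also have "\<dots> = (\<Sum>l<card G. cnj (Z l i) * Z l j)" by (simp add: Z_def)
    also have "\<dots> = (\<Sum>l<N. cnj (Z l i) * Z l j)"
      using \<open>card G \<le> N\<close> by (intro sum.mono_neutral_left) (auto simp: Z_def)
    finally show ?thesis .
  qed
  then show ?thesis by blast
qed

section \<open>Compressions of the GNS representation\<close>

lemma positive_functional_sum:
  assumes "positive_functional F"
  shows "F (\<Sum>i\<in>I. f i) = (\<Sum>i\<in>I. F (f i))"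
proof -
  have "F 0 = 0" using positive_functional_scale[OF assms, of 0 0] by simp
  then show ?thesis
    by (induction I rule: infinite_finite_induct) (simp_all add: positive_functional_add[OF assms])
qed

lemma positive_functional_hermitian:
  assumes "positive_functional F"
  shows "F (star y * x) = cnj (F (star x * y))"
  using positive_functional_star[OF assms, of "star x * y"] by (simp add: star_mult star_star)

lemma positive_functional_add_fun:
  assumes "positive_functional F" "positive_functional G"
  shows "positive_functional (\<lambda>x. F x + G x)"
  using assms by (simp add: positive_functional_def algebra_simps)

lemma semi_inner_pullback:
  assumes F: "positive_functional F" and \<iota>: "unital_star_hom \<iota>"
  shows "semi_inner scaleC (\<lambda>x y. F (star (\<iota> x) * \<iota> y))"
proof (intro semi_inner.intro semi_inner_axioms.intro complex_vs.vector_space_axioms)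
  fix x y z c
  show "F (star (\<iota> x) * \<iota> (y + z)) = F (star (\<iota> x) * \<iota> y) + F (star (\<iota> x) * \<iota> z)"
    using \<iota> by (simp add: unital_star_hom_def distrib_left positive_functional_add[OF F])
  show "F (star (\<iota> x) * \<iota> (c *\<^sub>C y)) = c * F (star (\<iota> x) * \<iota> y)"
    using \<iota> by (simp add: unital_star_hom_def mult_scaleC_right positive_functional_scale[OF F])
  show "F (star (\<iota> y) * \<iota> x) = cnj (F (star (\<iota> x) * \<iota> y))"
    by (rule positive_functional_hermitian[OF F])
  show "0 \<le> Re (F (star (\<iota> x) * \<iota> x))" by (rule positive_functional_nonneg[OF F])
qed

lemma semi_inner_positive_functional:
  "positive_functional F \<Longrightarrow> semi_inner scaleC (\<lambda>x y. F (star x * y))"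
  using semi_inner_pullback[of F "\<lambda>x. x"] by (simp add: unital_star_hom_def)

text \<open>Left multiplication is bounded on the GNS space: for \<open>a'\<close> of norm 1 the
  element \<open>1 - star a' * a'\<close> is the square of the self-adjoint \<open>1 - c\<close>, so
  the two sides differ by the value of \<open>F\<close> at \<open>star v * v\<close> with
  \<open>v = (1 - c) * w\<close>.\<close>

lemma positive_functional_mult_le:
  fixes a w :: "'a::cstar_algebra"
  assumes F: "positive_functional F"
  shows "Re (F (star (a * w) * (a * w))) \<le> (norm a)\<^sup>2 * Re (F (star w * w))"
proof (cases "a = 0")
  case True
  then show ?thesis using positive_functional_scale[OF F, of 0 0] by simp
next
  case False
  define a' where "a' = (1 / norm a) *\<^sub>R a"
  have na': "norm a' = 1" using False by (simp add: a'_def)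
  have "norm (star a' * a') \<le> 1" by (simp add: cstar_identity na')
  moreover have "star (star a' * a') = star a' * a'" by (simp add: star_mult star_star)
  ultimately obtain c where c: "star c = c" "norm c \<le> 1" "(1 - c) * (1 - c) = 1 - star a' * a'"
    by (rule sqrt_one_minus) blast
  have "star ((1 - c) * w) * ((1 - c) * w) = star w * ((1 - c) * (1 - c)) * w"
    by (simp add: star_mult star_diff star_one c(1) mult.assoc)
  also have "\<dots> = star w * w - star (a' * w) * (a' * w)"
    unfolding c(3) by (simp add: star_mult algebra_simps)
  finally have e: "star w * w = star ((1 - c) * w) * ((1 - c) * w) + star (a' * w) * (a' * w)"
    by simp
  have "Re (F (star (a' * w) * (a' * w))) \<le> Re (F (star w * w))"
    unfolding e positive_functional_add[OF F] using positive_functional_nonneg[OF F] by simp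
  moreover have "star (a * w) * (a * w) = complex_of_real ((norm a)\<^sup>2) *\<^sub>C (star (a' * w) * (a' * w))"
    unfolding scaleR_eq_scaleC[symmetric]
    using False by (simp add: a'_def star_mult star_scaleR power2_eq_square)
  ultimately show ?thesis
    by (simp only: positive_functional_scale[OF F]) (simp add: mult_left_mono)
qed

text \<open>If \<open>F\<close> is faithful on the span of \<open>B\<close>, its null vectors in the span of \<open>insert b B\<close> form a space
  of dimension at most one, so one further functional suffices.\<close>

lemma ex_faithful_positive_functional:
  fixes \<iota> :: "'a::pre_cstar_algebra \<Rightarrow> 'b::cstar_algebra"
  assumes \<iota>: "unital_star_hom \<iota>" and isom: "\<And>x. norm (\<iota> x) = norm x" and "finite B"
  shows "\<exists>F. positive_functional F \<and>
    (\<forall>v\<in>complex_vs.span B. v \<noteq> 0 \<longrightarrow> 0 < Re (F (star (\<iota> v) * \<iota> v)))"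
  using \<open>finite B\<close>
proof (induction B rule: finite_induct)
  case empty
  \<comment> \<open>Positive functionals carry no normalization, so zero starts the induction and
    sums continue it.\<close>
  have "positive_functional (\<lambda>_::'b. 0)" by (simp add: positive_functional_def)
  then show ?case by auto
next
  case (insert b B)
  then obtain F where F: "positive_functional F"
    and faithful: "\<And>v. v \<in> complex_vs.span B \<Longrightarrow> v \<noteq> 0 \<Longrightarrow> 0 < Re (F (star (\<iota> v) * \<iota> v))"
    by blast
  interpret A: semi_inner scaleC "\<lambda>x y. F (star (\<iota> x) * \<iota> y)"
    using F \<iota> by (rule semi_inner_pullback)
  show ?case
  proof (cases "\<exists>v\<in>complex_vs.span (insert b B). v \<noteq> 0 \<and> A.nsq v = 0")
    case False
    then have "0 < A.nsq v" if "v \<in> complex_vs.span (insert b B)" "v \<noteq> 0" for v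
      using that A.nsq_nonneg[of v] by (metis order_le_less)
    then show ?thesis using F unfolding A.nsq_def by blast
  next
    case True
    then obtain u where u: "u \<in> complex_vs.span (insert b B)" "u \<noteq> 0" "A.nsq u = 0" by blast
    obtain k where k: "u - k *\<^sub>C b \<in> complex_vs.span B"
      using u(1) complex_vs.span_breakdown_eq by blast
    have "k \<noteq> 0" using faithful[of u] k u(2,3) by (auto simp: A.nsq_def)
    have "norm (\<iota> u) \<noteq> 0" using u(2) by (simp add: isom)
    then have "\<iota> u \<noteq> 0" by auto
    then obtain F' where F': "positive_functional F'" "Re (F' (star (\<iota> u) * \<iota> u)) > 0"
      using ex_positive_functional by blast
    interpret A': semi_inner scaleC "\<lambda>x y. F' (star (\<iota> x) * \<iota> y)"
      using F'(1) \<iota> by (rule semi_inner_pullback)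
    have "0 < A.nsq v + A'.nsq v" if v: "v \<in> complex_vs.span (insert b B)" "v \<noteq> 0" for v
    proof (cases "A.nsq v = 0")
      case False
      then show ?thesis using A.nsq_nonneg[of v] A'.nsq_nonneg[of v] by linarith
    next
      case True
      obtain l where l: "v - l *\<^sub>C b \<in> complex_vs.span B"
        using v(1) complex_vs.span_breakdown_eq by blast
      \<comment> \<open>Chosen to cancel the \<open>b\<close>-component of \<open>v\<close>: then
        \<open>z\<close> lies in the span of \<open>B\<close> and is null, hence zero, and
        \<open>v\<close> is a multiple of \<open>u\<close>.\<close>
      define c where "c = - (l / k)"
      define z where "z = v + c *\<^sub>C u"
      have "z = (v - l *\<^sub>C b) - (l / k) *\<^sub>C (u - k *\<^sub>C b)"
        using \<open>k \<noteq> 0\<close> by (simp add: z_def c_def complex_vs.scale_right_diff_distrib)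
      then have "z \<in> complex_vs.span B"
        using l k by (simp only: complex_vs.span_diff complex_vs.span_scale)
      moreover have "A.nsq z \<le> 0"
        using A.nsq_add_le[of v "c *\<^sub>C u"] True u(3) by (simp add: z_def A.nsq_scale)
      ultimately have "z = 0" using faithful[of z] by (force simp: A.nsq_def)
      then have vu: "v = (l / k) *\<^sub>C u" by (simp add: z_def c_def)
      then have "l / k \<noteq> 0" using v(2) by auto
      moreover have "A'.nsq u > 0" using F'(2) by (simp add: A'.nsq_def)
      ultimately have "A'.nsq v > 0" unfolding vu A'.nsq_scale by simp
      then show ?thesis using True by simp
    qed
    then show ?thesis
      using positive_functional_add_fun[OF F F'(1)] unfolding A.nsq_def A'.nsq_def
      by (intro exI[of _ "\<lambda>x. F x + F' x"]) simp
  qed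
qed

section \<open>Complex matrices and completely positive compressions\<close>

lemma norm_2_tr_eq:
  assumes T: "T \<in> carrier_mat k k"
  shows "norm_2_tr T = sqrt ((\<Sum>j<k. \<Sum>i<k. (cmod (T $$ (i, j)))\<^sup>2) / real k)"
proof -
  have "(mat_star T * T) $$ (j, j) = complex_of_real (\<Sum>i<k. (cmod (T $$ (i, j)))\<^sup>2)" if "j < k" for j
    using T that
    by (simp add: mat_star_def scalar_prod_def star_complex_def complex_norm_square mult.commute
        atLeast0LessThan del: of_real_power)
  then have "(\<Sum>j<k. (mat_star T * T) $$ (j, j)) =
      complex_of_real (\<Sum>j<k. \<Sum>i<k. (cmod (T $$ (i, j)))\<^sup>2)"
    by simp
  moreover have "dim_row (mat_star T * T) = k" using T by (simp add: mat_star_def)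
  ultimately have "normalized_trace (mat_star T * T) =
      complex_of_real ((\<Sum>j<k. \<Sum>i<k. (cmod (T $$ (i, j)))\<^sup>2) / real k)"
    unfolding normalized_trace_def by simp
  then show ?thesis unfolding norm_2_tr_def by (simp only: Re_complex_of_real)
qed

lemma mat_positive_complexI:
  assumes X: "X \<in> carrier_mat N N"
    and herm: "\<And>i j. i < N \<Longrightarrow> j < N \<Longrightarrow> X $$ (j, i) = cnj (X $$ (i, j))"
    and pos: "\<And>c. 0 \<le> Re (\<Sum>i<N. \<Sum>j<N. cnj (c i) * X $$ (i, j) * c j)"
  shows "mat_positive N X"
proof -
  obtain Z where Z: "\<forall>i<N. \<forall>j<N. X $$ (i, j) = (\<Sum>l<N. cnj (Z l i) * Z l j)"
    using positive_semidefinite_factorization[of N "\<lambda>i j. X $$ (i, j)", OF herm pos] by blast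
  define Y where "Y = Matrix.mat N N (\<lambda>(l, i). Z l i)"
  have "X = mat_star Y * Y"
    using X by (intro eq_matI)
      (auto simp: Y_def mat_star_def scalar_prod_def star_complex_def Z atLeast0LessThan)
  then show ?thesis unfolding mat_positive_def by (intro bexI[of _ Y]) (simp_all add: Y_def)
qed

text \<open>The compression \<open>x \<mapsto> P x P\<close> to the span of the vectors \<open>w 0, \<dots>, w (k - 1)\<close> of the GNS space of
  \<open>F\<close>, in the basis \<open>w\<close>.\<close>

locale compression =
  fixes F :: "'b::cstar_algebra \<Rightarrow> complex" and k :: nat and w :: "nat \<Rightarrow> 'b"
  assumes F: "positive_functional F"
    and w: "\<And>i j. i < k \<Longrightarrow> j < k \<Longrightarrow> F (star (w i) * w j) = (if i = j then 1 else 0)"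
begin

sublocale gns: semi_inner scaleC "\<lambda>x y. F (star x * y)"
  using F by (rule semi_inner_positive_functional)

definition \<phi> :: "'b \<Rightarrow> complex mat" where
  "\<phi> x = Matrix.mat k k (\<lambda>(i, j). F (star (w i) * (x * w j)))"

abbreviation ws :: "'b set" where
  "ws \<equiv> w ` {..<k}"

lemma inj_w: "inj_on w {..<k}"
proof (rule inj_onI)
  fix i j assume "i \<in> {..<k}" "j \<in> {..<k}" "w i = w j"
  then show "i = j" using w[of i j] w[of i i] by (auto split: if_splits)
qed

lemma orthonormal_ws: "gns.orthonormal ws"
  using w inj_onD[OF inj_w] by (auto simp: gns.orthonormal_def)

text \<open>An index \<open>r\<close> stands for the block \<open>r div k\<close> and the vector
  \<open>w (r mod k)\<close>. Factoring \<open>X = mat_star Y * Y\<close> makes the amplification a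
  sum over \<open>l\<close> of Gram matrices of the vectors \<open>y l r\<close>, so its quadratic
  form is the sum of the nonnegative \<open>F (star (z l) * z l)\<close>.\<close>

lemma completely_positive_\<phi>:
  assumes X: "X \<in> carrier_mat n n" "mat_positive n X"
  shows "mat_positive (n * k) (amplification n k \<phi> X)"
proof -
  obtain Y where Y: "Y \<in> carrier_mat n n" "X = mat_star Y * Y"
    using X(2) unfolding mat_positive_def by blast
  define y where "y l r = Y $$ (l, r div k) * w (r mod k)" for l r
  have entry: "amplification n k \<phi> X $$ (r, t) = (\<Sum>l<n. F (star (y l r) * y l t))"
    if rt: "r < n * k" "t < n * k" for r t
  proof -
    have "k > 0" using rt by (cases k) auto
    have div: "r div k < n" "t div k < n" using rt by (simp_all add: less_mult_imp_div_less)
    have "X $$ (r div k, t div k) = (\<Sum>l<n. star (Y $$ (l, r div k)) * Y $$ (l, t div k))"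
      using div Y by (simp add: mat_star_def scalar_prod_def atLeast0LessThan)
    then have "star (w (r mod k)) * (X $$ (r div k, t div k) * w (t mod k)) =
        (\<Sum>l<n. star (y l r) * y l t)"
      by (simp add: y_def sum_distrib_left sum_distrib_right star_mult mult.assoc)
    then show ?thesis
      using rt \<open>k > 0\<close> by (simp add: amplification_def \<phi>_def positive_functional_sum[OF F])
  qed
  show ?thesis
  proof (rule mat_positive_complexI)
    show "amplification n k \<phi> X \<in> carrier_mat (n * k) (n * k)" by (simp add: amplification_def)
    show "amplification n k \<phi> X $$ (t, r) = cnj (amplification n k \<phi> X $$ (r, t))"
      if "r < n * k" "t < n * k" for r t
      unfolding entry[OF that] entry[OF that(2,1)] cnj_sum
      by (intro sum.cong refl positive_functional_hermitian[OF F])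
    fix c :: "nat \<Rightarrow> complex"
    define z where "z l = (\<Sum>r<n * k. c r *\<^sub>C y l r)" for l
    have "F (star (z l) * z l) = (\<Sum>r<n * k. \<Sum>t<n * k. cnj (c r) * F (star (y l r) * y l t) * c t)" for l
      by (simp add: z_def star_sum star_scaleC sum_distrib_left sum_distrib_right
          positive_functional_sum[OF F] mult_scaleC_left mult_scaleC_right
          positive_functional_scale[OF F] mult.commute mult.left_commute)
        (subst sum.swap, rule refl)
    then have "(\<Sum>l<n. F (star (z l) * z l)) =
        (\<Sum>l<n. \<Sum>r<n * k. \<Sum>t<n * k. cnj (c r) * F (star (y l r) * y l t) * c t)"
      by simp
    also have "\<dots> = (\<Sum>r<n * k. \<Sum>t<n * k. \<Sum>l<n. cnj (c r) * F (star (y l r) * y l t) * c t)"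
      by (subst sum.swap, rule sum.cong[OF refl], rule sum.swap)
    also have "\<dots> = (\<Sum>r<n * k. \<Sum>t<n * k. cnj (c r) * amplification n k \<phi> X $$ (r, t) * c t)"
      by (simp add: entry sum_distrib_left sum_distrib_right)
    finally show "0 \<le> Re (\<Sum>r<n * k. \<Sum>t<n * k. cnj (c r) * amplification n k \<phi> X $$ (r, t) * c t)"
      by (rule subst) (simp add: Re_sum sum_nonneg positive_functional_nonneg[OF F])
  qed
qed

lemma unital_completely_positive_\<phi>: "unital_completely_positive k \<phi>"
  unfolding unital_completely_positive_def
proof (intro conjI allI ballI impI)
  fix x y and c :: complex
  show "\<phi> x \<in> carrier_mat k k" by (simp add: \<phi>_def)
  show "\<phi> (x + y) = \<phi> x + \<phi> y"
    by (intro eq_matI) (simp_all add: \<phi>_def distrib_left distrib_right positive_functional_add[OF F])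
  show "\<phi> (c *\<^sub>C x) = c \<cdot>\<^sub>m \<phi> x"
    by (intro eq_matI)
      (simp_all add: \<phi>_def mult_scaleC_left mult_scaleC_right positive_functional_scale[OF F])
  show "\<phi> 1 = 1\<^sub>m k" by (intro eq_matI) (simp_all add: \<phi>_def w)
qed (rule completely_positive_\<phi>)

lemma multiplicative_defect:
  assumes "i < k" "j < k"
  shows "(\<phi> (A * B) - \<phi> A * \<phi> B) $$ (i, j) = F (star (w i) * (A * gns.residual ws (B * w j)))"
proof -
  have "(\<phi> A * \<phi> B) $$ (i, j) = (\<Sum>l<k. F (star (w l) * (B * w j)) * F (star (w i) * (A * w l)))"
    using assms by (simp add: \<phi>_def scalar_prod_def atLeast0LessThan mult.commute)
  moreover have "gns.residual ws (B * w j) = B * w j - (\<Sum>l<k. F (star (w l) * (B * w j)) *\<^sub>C w l)"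
    by (simp add: gns.residual_def sum.reindex[OF inj_w])
  moreover have "F (star (w i) * (A * (x - y))) = F (star (w i) * (A * x)) - F (star (w i) * (A * y))" for x y
    using gns.diff_right[of "w i" "A * x" "A * y"] by (simp add: right_diff_distrib)
  ultimately show ?thesis
    using assms
    by (simp add: \<phi>_def sum_distrib_left mult_scaleC_right mult.assoc
        positive_functional_sum[OF F] positive_functional_scale[OF F])
qed

text \<open>Column \<open>j\<close> of the defect consists of coefficients of
  \<open>A * gns.residual ws (B * w j)\<close>, so Bessel and the boundedness of \<open>A\<close>
  apply column by column. What remains is how far \<open>B\<close> moves the span out of itself,
  which is what \<open>dim (b W + W)\<close> measures.\<close>

lemma norm_multiplicative_defect_le:
  "(norm_2_tr (\<phi> (A * B) - \<phi> A * \<phi> B))\<^sup>2 \<le>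
     (norm A)\<^sup>2 * (\<Sum>j<k. gns.nsq (gns.residual ws (B * w j))) / real k"
proof -
  let ?e = "\<lambda>j. gns.residual ws (B * w j)"
  have "(\<Sum>i<k. (cmod (F (star (w i) * (A * ?e j))))\<^sup>2) \<le> (norm A)\<^sup>2 * gns.nsq (?e j)" for j
  proof -
    have "(\<Sum>i<k. (cmod (F (star (w i) * (A * ?e j))))\<^sup>2) \<le> gns.nsq (A * ?e j)"
      using gns.bessel[OF orthonormal_ws, of "A * ?e j"] by (simp add: sum.reindex[OF inj_w])
    also have "\<dots> \<le> (norm A)\<^sup>2 * gns.nsq (?e j)"
      unfolding gns.nsq_def by (rule positive_functional_mult_le[OF F])
    finally show ?thesis .
  qed
  then have "(\<Sum>j<k. \<Sum>i<k. (cmod (F (star (w i) * (A * ?e j))))\<^sup>2) \<le> (\<Sum>j<k. (norm A)\<^sup>2 * gns.nsq (?e j))"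
    by (rule sum_mono)
  moreover have "\<phi> (A * B) - \<phi> A * \<phi> B \<in> carrier_mat k k"
    by (intro minus_carrier_mat mult_carrier_mat[of _ k k]) (simp_all add: \<phi>_def)
  ultimately show ?thesis
    by (simp add: norm_2_tr_eq multiplicative_defect sum_nonneg sum_distrib_left divide_right_mono)
qed

lemma nsq_residual_mult_le:
  assumes "j < k"
  shows "gns.nsq (gns.residual ws (B * w j)) \<le> (norm B)\<^sup>2"
proof -
  have "gns.nsq (gns.residual ws (B * w j)) \<le> gns.nsq (B * w j)"
    by (rule gns.nsq_residual_le[OF orthonormal_ws])
  also have "\<dots> \<le> (norm B)\<^sup>2 * Re (F (star (w j) * w j))"
    unfolding gns.nsq_def by (rule positive_functional_mult_le[OF F])
  finally show ?thesis using assms w by simp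
qed

end

section \<open>Almost invariant subspaces\<close>

lemma card_le_dim_sum:
  fixes b :: "'a::complex_algebra"
  assumes G: "finite G" "complex_vs.span G = W"
    and G': "complex_vs.independent G'" "G' \<subseteq> complex_vs.span ((\<lambda>g. b * g) ` G \<union> G)"
  shows "card G' \<le> complex_vs.dim {b * v + w | v w. v \<in> W \<and> w \<in> W}"
proof -
  define E where "E = (\<lambda>g. b * g) ` G \<union> G"
  define U where "U = {b * v + w | v w. v \<in> W \<and> w \<in> W}"
  have "W \<subseteq> {v. b * v \<in> complex_vs.span E}"
    unfolding G(2)[symmetric]
  proof (rule complex_vs.span_minimal)
    show "G \<subseteq> {v. b * v \<in> complex_vs.span E}"
      by (auto simp: E_def intro: complex_vs.span_base)
    show "complex_vs.subspace {v. b * v \<in> complex_vs.span E}"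
      by (auto simp: complex_vs.subspace_def distrib_left mult_scaleC_right
          complex_vs.span_zero complex_vs.span_add complex_vs.span_scale)
  qed
  moreover have "W \<subseteq> complex_vs.span E"
    unfolding G(2)[symmetric] by (rule complex_vs.span_mono) (simp add: E_def)
  ultimately have U: "U \<subseteq> complex_vs.span E"
    by (auto simp: U_def intro!: complex_vs.span_add)
  obtain B where B: "B \<subseteq> U" "complex_vs.independent B" "U \<subseteq> complex_vs.span B"
      "card B = complex_vs.dim U"
    by (rule complex_vs.basis_exists)
  have "finite E" using G(1) by (simp add: E_def)
  \<comment> \<open>An infinite basis would have \<open>card B = 0\<close>, and the comparison of
    cardinalities would break down.\<close>
  then have "finite B" using complex_vs.independent_span_bound[OF _ B(2)] B(1) U by blast
  have GW: "G \<subseteq> W" "0 \<in> W"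
    unfolding G(2)[symmetric] by (rule complex_vs.span_superset, rule complex_vs.span_zero)
  have "E \<subseteq> U"
  proof
    fix x assume "x \<in> E"
    then consider g where "g \<in> G" "x = b * g + 0" | "x \<in> G" "x = b * 0 + x"
      by (auto simp: E_def)
    then show "x \<in> U" unfolding U_def using GW by cases blast+
  qed
  then have "complex_vs.span E \<subseteq> complex_vs.span B"
    using B(3) by (intro complex_vs.span_minimal) auto
  then have "card G' \<le> card B"
    using complex_vs.independent_span_bound[OF \<open>finite B\<close> G'(1)] G'(2) by (auto simp: E_def)
  then show ?thesis using B(4) by (simp add: U_def)
qed

text \<open>The map depends on \<open>W\<close> only, while \<open>b\<close> and
  \<open>\<epsilon>\<close> are quantified inside the conclusion; so one map serves a whole finite
  set of elements. The two terms of the bound come from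
  \<open>B = \<iota> b + (B - \<iota> b)\<close>, the factors 2 from
  \<open>nsq_add_le\<close>.\<close>

lemma almost_invariant_compression:
  fixes \<iota> :: "'a::pre_cstar_algebra \<Rightarrow> 'b::cstar_algebra"
  assumes \<iota>: "cstar_completion \<iota>" and W: "finite_dim_subspace W" "W \<noteq> {0}"
  obtains k \<phi> where "k \<ge> 1" "unital_completely_positive k \<phi>"
    "\<And>A B b \<epsilon>.
      real (complex_vs.dim {b * v + w | v w. v \<in> W \<and> w \<in> W}) \<le> (1 + \<epsilon>) * real (complex_vs.dim W) \<Longrightarrow>
      (norm_2_tr (\<phi> (A * B) - \<phi> A * \<phi> B))\<^sup>2 \<le>
        (norm A)\<^sup>2 * (2 * \<epsilon> * (norm b)\<^sup>2 + 2 * (norm (B - \<iota> b))\<^sup>2)"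
proof -
  have hom: "unital_star_hom \<iota>" and isom: "norm (\<iota> x) = norm x" for x
    using \<iota> by (auto simp: cstar_completion_def)
  have \<iota>_simps: "\<iota> (x + y) = \<iota> x + \<iota> y" "\<iota> (c *\<^sub>C x) = c *\<^sub>C \<iota> x" "\<iota> (x * y) = \<iota> x * \<iota> y" for x y c
    using hom by (auto simp: unital_star_hom_def)
  have \<iota>_0: "\<iota> 0 = 0" using \<iota>_simps(1)[of 0 0] by simp
  have \<iota>_sum: "\<iota> (\<Sum>i\<in>I. f i) = (\<Sum>i\<in>I. \<iota> (f i))" for I and f :: "'a \<Rightarrow> 'a"
    by (induction I rule: infinite_finite_induct) (simp_all add: \<iota>_0 \<iota>_simps)
  have \<iota>_diff: "\<iota> (x - y) = \<iota> x - \<iota> y" for x y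
    using \<iota>_simps(1)[of "x - y" y] by simp
  obtain E where E: "finite E" "complex_vs.span E = W"
    using W(1) by (auto simp: finite_dim_subspace_def)
  obtain F where F: "positive_functional F"
    and faithful: "\<And>v. v \<in> W \<Longrightarrow> v \<noteq> 0 \<Longrightarrow> 0 < Re (F (star (\<iota> v) * \<iota> v))"
    using ex_faithful_positive_functional[OF hom isom E(1)] E(2) by blast
  interpret A: semi_inner scaleC "\<lambda>x y. F (star (\<iota> x) * \<iota> y)"
    using F hom by (rule semi_inner_pullback)
  have "A.orthonormal {}" by (simp add: A.orthonormal_def)
  then obtain G where G: "A.orthonormal G" "G \<subseteq> W" "\<forall>e\<in>E. A.nsq (A.residual G e) = 0"
    using A.gram_schmidt[OF E(1), of "{}"] E(2) by auto
  have "finite G" using G(1) by (simp add: A.orthonormal_def)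
  have spanG: "complex_vs.span G = W"
  proof
    show "complex_vs.span G \<subseteq> W"
      using G(2) W(1) by (intro complex_vs.span_minimal) (simp_all add: finite_dim_subspace_def)
    have "e \<in> complex_vs.span G" if "e \<in> E" for e
    proof -
      have proj: "(\<Sum>g\<in>G. F (star (\<iota> g) * \<iota> e) *\<^sub>C g) \<in> complex_vs.span G"
        by (intro complex_vs.span_sum complex_vs.span_scale complex_vs.span_base)
      have "e \<in> W" using that E(2) complex_vs.span_base by blast
      then have "A.residual G e \<in> W"
        using proj \<open>complex_vs.span G \<subseteq> W\<close> unfolding A.residual_def E(2)[symmetric]
        by (intro complex_vs.span_diff) auto
      \<comment> \<open>Here faithfulness enters: null vectors of \<open>W\<close> are zero. So
        \<open>G\<close> spans \<open>W\<close>, and the matrix size \<open>k\<close> is the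
        dimension that amenability counts.\<close>
      then have "A.residual G e = 0" using faithful G(3) that by (force simp: A.nsq_def)
      then show ?thesis using proj by (simp add: A.residual_def)
    qed
    then show "W \<subseteq> complex_vs.span G"
      unfolding E(2)[symmetric] by (intro complex_vs.span_minimal) auto
  qed
  define k where "k = card G"
  have dimW: "complex_vs.dim W = k"
    unfolding k_def using spanG A.orthonormal_independent[OF G(1)]
    by (intro complex_vs.dim_eq_card) (metis complex_vs.span_span)+
  have "k \<ge> 1"
  proof -
    have "G \<noteq> {}" using spanG W(2) by auto
    then show ?thesis using \<open>finite G\<close> by (simp add: k_def Suc_le_eq card_gt_0_iff)
  qed
  obtain h where h: "bij_betw h {..<k} G"
    using \<open>finite G\<close> ex_bij_betw_nat_finite[of G] by (auto simp: atLeast0LessThan k_def)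
  have hG: "h i \<in> G" if "i < k" for i using h that by (auto simp: bij_betw_def)
  have h_inj: "h i = h j \<longleftrightarrow> i = j" if "i < k" "j < k" for i j
    using h that by (auto simp: bij_betw_def inj_on_def)
  interpret C: compression F k "\<lambda>i. \<iota> (h i)"
  proof
    show "positive_functional F" by (rule F)
    show "F (star (\<iota> (h i)) * \<iota> (h j)) = (if i = j then 1 else 0)" if "i < k" "j < k" for i j
      using G(1) hG that by (simp add: A.orthonormal_def h_inj)
  qed
  have residual: "C.gns.residual C.ws (\<iota> x) = \<iota> (A.residual G x)" for x
  proof -
    have "C.gns.residual C.ws (\<iota> x) = \<iota> x - (\<Sum>i<k. F (star (\<iota> (h i)) * \<iota> x) *\<^sub>C \<iota> (h i))"
      by (simp add: C.gns.residual_def sum.reindex[OF C.inj_w])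
    also have "\<dots> = \<iota> x - (\<Sum>g\<in>G. F (star (\<iota> g) * \<iota> x) *\<^sub>C \<iota> g)"
      using sum.reindex_bij_betw[OF h, of "\<lambda>g. F (star (\<iota> g) * \<iota> x) *\<^sub>C \<iota> g"] by simp
    finally show ?thesis by (simp add: A.residual_def \<iota>_diff \<iota>_sum \<iota>_simps)
  qed
  \<comment> \<open>Rank times squared operator norm: at most \<open>\<epsilon> * real k\<close> new
    vectors suffice for \<open>b W + W\<close> beyond \<open>W\<close>, and each contributes at most
    the squared norm of \<open>b\<close>.\<close>
  have rank: "(\<Sum>j<k. C.gns.nsq (C.gns.residual C.ws (\<iota> b * \<iota> (h j)))) \<le> \<epsilon> * real k * (norm b)\<^sup>2"
    if dim: "real (complex_vs.dim {b * v + w | v w. v \<in> W \<and> w \<in> W}) \<le> (1 + \<epsilon>) * real k" for b \<epsilon>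
  proof -
    have "finite ((\<lambda>g. b * g) ` G)" using \<open>finite G\<close> by simp
    then obtain G' where G': "A.orthonormal G'" "G \<subseteq> G'"
        "G' \<subseteq> complex_vs.span ((\<lambda>g. b * g) ` G \<union> G)"
        "\<forall>e\<in>(\<lambda>g. b * g) ` G. A.nsq (A.residual G' e) = 0"
      using A.gram_schmidt[OF _ G(1)] by blast
    have "finite G'" using G'(1) by (simp add: A.orthonormal_def)
    have "card G' \<le> complex_vs.dim {b * v + w | v w. v \<in> W \<and> w \<in> W}"
      using \<open>finite G\<close> spanG A.orthonormal_independent[OF G'(1)] G'(3)
      by (rule card_le_dim_sum)
    then have "real (card G') \<le> (1 + \<epsilon>) * real k" using dim by linarith
    moreover have "card (G' - G) = card G' - k" "k \<le> card G'"
      using \<open>finite G\<close> \<open>finite G'\<close> G'(2) by (simp_all add: k_def card_Diff_subset card_mono)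
    ultimately have extra: "real (card (G' - G)) \<le> \<epsilon> * real k"
      by (simp add: of_nat_diff algebra_simps)
    have "(\<Sum>j<k. C.gns.nsq (C.gns.residual C.ws (\<iota> b * \<iota> (h j)))) =
        (\<Sum>j<k. \<Sum>g\<in>G' - G. (cmod (F (star (\<iota> g) * \<iota> (b * h j))))\<^sup>2)"
    proof (rule sum.cong[OF refl])
      fix j assume "j \<in> {..<k}"
      then have "A.nsq (A.residual G' (b * h j)) = 0" using G'(4) hG by auto
      then have "A.nsq (A.residual G (b * h j)) = (\<Sum>g\<in>G' - G. (cmod (F (star (\<iota> g) * \<iota> (b * h j))))\<^sup>2)"
        using A.nsq_residual_mono[OF G'(1,2), of "b * h j"] by simp
      moreover have "C.gns.nsq (C.gns.residual C.ws (\<iota> b * \<iota> (h j))) = A.nsq (A.residual G (b * h j))"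
        using residual[of "b * h j"] by (simp add: C.gns.nsq_def A.nsq_def \<iota>_simps)
      ultimately show "C.gns.nsq (C.gns.residual C.ws (\<iota> b * \<iota> (h j))) =
          (\<Sum>g\<in>G' - G. (cmod (F (star (\<iota> g) * \<iota> (b * h j))))\<^sup>2)" by simp
    qed
    \<comment> \<open>Summing over \<open>j\<close> first avoids a factor \<open>k\<close>: for
      fixed \<open>g\<close>, moving \<open>b\<close> to the other side lets Bessel bound the whole
      row by the squared length of \<open>star (\<iota> b) * \<iota> g\<close>.\<close>
    also have "\<dots> = (\<Sum>g\<in>G' - G. \<Sum>j<k. (cmod (F (star (\<iota> g) * \<iota> (b * h j))))\<^sup>2)"
      by (rule sum.swap)
    also have "\<dots> \<le> (\<Sum>g\<in>G' - G. (norm b)\<^sup>2)"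
    proof (rule sum_mono)
      fix g assume "g \<in> G' - G"
      then have gg: "F (star (\<iota> g) * \<iota> g) = 1" using G'(1) by (simp add: A.orthonormal_def)
      have "(\<Sum>j<k. (cmod (F (star (\<iota> g) * \<iota> (b * h j))))\<^sup>2) =
          (\<Sum>j<k. (cmod (F (star (\<iota> (h j)) * (star (\<iota> b) * \<iota> g))))\<^sup>2)"
      proof (rule sum.cong[OF refl])
        fix j
        have "star (\<iota> g) * \<iota> (b * h j) = star (star (\<iota> b) * \<iota> g) * \<iota> (h j)"
          by (simp add: \<iota>_simps star_mult star_star mult.assoc)
        then have "F (star (\<iota> g) * \<iota> (b * h j)) = cnj (F (star (\<iota> (h j)) * (star (\<iota> b) * \<iota> g)))"
          using positive_functional_hermitian[OF F, of "star (\<iota> b) * \<iota> g" "\<iota> (h j)"] by simp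
        then show "(cmod (F (star (\<iota> g) * \<iota> (b * h j))))\<^sup>2 =
            (cmod (F (star (\<iota> (h j)) * (star (\<iota> b) * \<iota> g))))\<^sup>2" by simp
      qed
      also have "\<dots> \<le> C.gns.nsq (star (\<iota> b) * \<iota> g)"
        using C.gns.bessel[OF C.orthonormal_ws, of "star (\<iota> b) * \<iota> g"]
        by (simp add: sum.reindex[OF C.inj_w])
      also have "\<dots> \<le> (norm (star (\<iota> b)))\<^sup>2 * Re (F (star (\<iota> g) * \<iota> g))"
        unfolding C.gns.nsq_def by (rule positive_functional_mult_le[OF F])
      finally show "(\<Sum>j<k. (cmod (F (star (\<iota> g) * \<iota> (b * h j))))\<^sup>2) \<le> (norm b)\<^sup>2"
        by (simp add: gg isom)
    qed
    also have "\<dots> \<le> \<epsilon> * real k * (norm b)\<^sup>2"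
      using extra by (simp add: mult_right_mono)
    finally show ?thesis .
  qed
  have "(norm_2_tr (C.\<phi> (A * B) - C.\<phi> A * C.\<phi> B))\<^sup>2 \<le>
      (norm A)\<^sup>2 * (2 * \<epsilon> * (norm b)\<^sup>2 + 2 * (norm (B - \<iota> b))\<^sup>2)"
    if dim: "real (complex_vs.dim {b * v + w | v w. v \<in> W \<and> w \<in> W}) \<le> (1 + \<epsilon>) * real (complex_vs.dim W)"
    for A B b \<epsilon>
  proof -
    let ?r = "\<lambda>x j. C.gns.nsq (C.gns.residual C.ws (x * \<iota> (h j)))"
    have "(\<Sum>j<k. ?r B j) \<le> (\<Sum>j<k. 2 * ?r (\<iota> b) j + 2 * (norm (B - \<iota> b))\<^sup>2)"
    proof (rule sum_mono)
      fix j assume "j \<in> {..<k}"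
      have "B * \<iota> (h j) = \<iota> b * \<iota> (h j) + (B - \<iota> b) * \<iota> (h j)" by (simp add: algebra_simps)
      then have "?r B j \<le> 2 * ?r (\<iota> b) j + 2 * ?r (B - \<iota> b) j"
        by (simp only: C.gns.residual_add C.gns.nsq_add_le)
      also have "?r (B - \<iota> b) j \<le> (norm (B - \<iota> b))\<^sup>2"
        using \<open>j \<in> {..<k}\<close> by (intro C.nsq_residual_mult_le) simp
      finally show "?r B j \<le> 2 * ?r (\<iota> b) j + 2 * (norm (B - \<iota> b))\<^sup>2" by simp
    qed
    also have "\<dots> = 2 * (\<Sum>j<k. ?r (\<iota> b) j) + real k * (2 * (norm (B - \<iota> b))\<^sup>2)"
      by (simp add: sum.distrib sum_distrib_left)
    also have "\<dots> \<le> 2 * (\<epsilon> * real k * (norm b)\<^sup>2) + real k * (2 * (norm (B - \<iota> b))\<^sup>2)"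
      using rank[of b \<epsilon>] dim by (simp add: dimW)
    also have "\<dots> = real k * (2 * \<epsilon> * (norm b)\<^sup>2 + 2 * (norm (B - \<iota> b))\<^sup>2)"
      by (simp add: algebra_simps)
    finally have "(norm A)\<^sup>2 * (\<Sum>j<k. ?r B j) / real k \<le>
        (norm A)\<^sup>2 * (real k * (2 * \<epsilon> * (norm b)\<^sup>2 + 2 * (norm (B - \<iota> b))\<^sup>2)) / real k"
      by (intro divide_right_mono mult_left_mono) auto
    then show ?thesis
      using C.norm_multiplicative_defect_le[of A B] \<open>k \<ge> 1\<close> by simp
  qed
  then show ?thesis using \<open>k \<ge> 1\<close> C.unital_completely_positive_\<phi> by (intro that)
qed

section \<open>Approximation in norm and the resulting net\<close>

lemma ex_almost_multiplicative:
  fixes \<iota> :: "'a::pre_cstar_algebra \<Rightarrow> 'b::cstar_algebra"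
  assumes amenable: "algebraically_amenable TYPE('a)" and \<iota>: "cstar_completion \<iota>"
    and S: "finite S" and \<eta>: "\<eta> > 0"
  shows "\<exists>k \<phi>. k \<ge> 1 \<and> unital_completely_positive k \<phi> \<and>
    (\<forall>A\<in>S. \<forall>B\<in>S. \<bar>norm_2_tr (\<phi> (A * B) - \<phi> A * \<phi> (B::'b))\<bar> < \<eta>)"
proof -
  obtain K where K: "K \<ge> 1" "\<And>A. A \<in> S \<Longrightarrow> norm A \<le> K"
  proof
    show "norm A \<le> Max (insert 1 (norm ` S))" if "A \<in> S" for A
      using S that by auto
    show "Max (insert 1 (norm ` S)) \<ge> 1" using S by simp
  qed
  \<comment> \<open>With \<open>\<delta> \<le> 1\<close> the approximants have norm at most
    \<open>K + 1\<close>. The bound of the compression becomes \<open>K\<^sup>2 * (2 * \<epsilon> *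
    (K + 1)\<^sup>2 + 2 * \<delta>\<^sup>2)\<close>; the constants make its two terms at most a
    quarter and a half of \<open>\<eta>\<^sup>2\<close>.\<close>
  define \<delta> where "\<delta> = min 1 (\<eta> / (2 * K))"
  define \<epsilon> where "\<epsilon> = \<eta>\<^sup>2 / (8 * K\<^sup>2 * (K + 1)\<^sup>2)"
  have \<delta>: "0 < \<delta>" "\<delta> \<le> 1" "\<delta> \<le> \<eta> / (2 * K)" using \<eta> K(1) by (simp_all add: \<delta>_def)
  have \<epsilon>: "\<epsilon> > 0" using \<eta> K(1) by (simp add: \<epsilon>_def)
  have "\<exists>b. norm (B - \<iota> b) < \<delta>" for B
  proof -
    have "B \<in> closure (range \<iota>)" using \<iota> by (simp add: cstar_completion_def)
    then show ?thesis using \<delta>(1) unfolding closure_approachable by (auto simp: dist_norm norm_minus_commute)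
  qed
  then obtain \<beta> where \<beta>: "\<And>B. norm (B - \<iota> (\<beta> B)) < \<delta>" by metis
  have "finite (\<beta> ` S)" using S by simp
  from amenable[unfolded algebraically_amenable_def, rule_format, OF \<epsilon> this]
  obtain W where W: "finite_dim_subspace W" "W \<noteq> {0}"
    "\<forall>b\<in>\<beta> ` S. real (complex_vs.dim {b * v + w | v w. v \<in> W \<and> w \<in> W})
       \<le> (1 + \<epsilon>) * real (complex_vs.dim W)"
    by (elim exE conjE)
  obtain k \<phi> where \<phi>: "k \<ge> 1" "unital_completely_positive k \<phi>"
    "\<And>A B b \<epsilon>.
      real (complex_vs.dim {b * v + w | v w. v \<in> W \<and> w \<in> W}) \<le> (1 + \<epsilon>) * real (complex_vs.dim W) \<Longrightarrow>
      (norm_2_tr (\<phi> (A * B) - \<phi> A * \<phi> B))\<^sup>2 \<le>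
        (norm A)\<^sup>2 * (2 * \<epsilon> * (norm b)\<^sup>2 + 2 * (norm (B - \<iota> b))\<^sup>2)"
    by (rule almost_invariant_compression[OF \<iota> W(1,2)]) blast
  have "\<bar>norm_2_tr (\<phi> (A * B) - \<phi> A * \<phi> B)\<bar> < \<eta>" if AB: "A \<in> S" "B \<in> S" for A B
  proof -
    have "norm (\<iota> (\<beta> B)) \<le> norm B + norm (B - \<iota> (\<beta> B))"
      using norm_triangle_ineq4[of B "B - \<iota> (\<beta> B)"] by simp
    moreover have "norm (\<iota> (\<beta> B)) = norm (\<beta> B)" using \<iota> by (simp add: cstar_completion_def)
    ultimately have \<beta>_le: "norm (\<beta> B) \<le> K + 1" using K(2)[OF AB(2)] \<beta>[of B] \<delta>(2) by linarith
    have "(norm_2_tr (\<phi> (A * B) - \<phi> A * \<phi> B))\<^sup>2 \<le>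
        (norm A)\<^sup>2 * (2 * \<epsilon> * (norm (\<beta> B))\<^sup>2 + 2 * (norm (B - \<iota> (\<beta> B)))\<^sup>2)"
      using AB by (intro \<phi>(3) bspec[OF W(3)]) simp
    also have "\<dots> \<le> K\<^sup>2 * (2 * \<epsilon> * (K + 1)\<^sup>2 + 2 * (\<eta> / (2 * K))\<^sup>2)"
      using K(2)[OF AB(1)] \<beta>_le \<beta>[of B] \<delta>(3) \<epsilon>
      by (intro mult_mono add_mono mult_left_mono power_mono) auto
    also have "\<dots> = \<eta>\<^sup>2 / 4 + \<eta>\<^sup>2 / 2"
    proof -
      have "K\<^sup>2 * (2 * \<epsilon> * (K + 1)\<^sup>2) = \<eta>\<^sup>2 / 4" "K\<^sup>2 * (2 * (\<eta> / (2 * K))\<^sup>2) = \<eta>\<^sup>2 / 2"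
        using K(1) by (simp_all add: \<epsilon>_def power_divide power_mult_distrib)
      then show ?thesis by (simp only: distrib_left)
    qed
    also have "\<dots> < \<eta>\<^sup>2" using zero_less_power[OF \<eta>, of 2] by linarith
    finally have "\<bar>norm_2_tr (\<phi> (A * B) - \<phi> A * \<phi> B)\<bar>\<^sup>2 < \<eta>\<^sup>2" by simp
    then show ?thesis by (rule power_less_imp_less_base) (use \<eta> in simp)
  qed
  then show ?thesis using \<phi>(1,2) by blast
qed

theorem theorem1:
  fixes \<iota> :: "'a::pre_cstar_algebra \<Rightarrow> 'b::cstar_algebra"
  assumes "algebraically_amenable TYPE('a)"
    and "cstar_completion \<iota>"
  shows "folner_cstar_algebra TYPE('b)"
proof -
  \<comment> \<open>An index pairs a finite set of elements with a tolerance
    \<open>1 / real (Suc n)\<close>, positive also for \<open>n = 0\<close>.\<close>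
  define J :: "('b set \<times> nat) set" where "J = {i. finite (fst i)}"
  define R :: "'b set \<times> nat \<Rightarrow> 'b set \<times> nat \<Rightarrow> bool" where
    "R i j \<longleftrightarrow> fst i \<subseteq> fst j \<and> snd i \<le> snd j" for i j
  have "\<forall>i. \<exists>k\<phi>. i \<in> J \<longrightarrow> fst k\<phi> \<ge> 1 \<and> unital_completely_positive (fst k\<phi>) (snd k\<phi>) \<and>
    (\<forall>A\<in>fst i. \<forall>B\<in>fst i. \<bar>norm_2_tr (snd k\<phi> (A * B) - snd k\<phi> A * snd k\<phi> B)\<bar> < 1 / real (Suc (snd i)))"
    using ex_almost_multiplicative[OF assms] by (simp add: J_def)
  then obtain q where q: "\<And>i. i \<in> J \<Longrightarrow> fst (q i) \<ge> 1 \<and> unital_completely_positive (fst (q i)) (snd (q i)) \<and>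
    (\<forall>A\<in>fst i. \<forall>B\<in>fst i.
      \<bar>norm_2_tr (snd (q i) (A * B) - snd (q i) A * snd (q i) B)\<bar> < 1 / real (Suc (snd i)))"
    by metis
  have "directed_set J R"
    unfolding directed_set_def
  proof (intro conjI ballI impI)
    have "({}, 0) \<in> J" by (simp add: J_def)
    then show "J \<noteq> {}" by blast
    fix i j assume "i \<in> J" "j \<in> J"
    then show "\<exists>l\<in>J. R i l \<and> R j l"
      by (intro bexI[of _ "(fst i \<union> fst j, max (snd i) (snd j))"]) (auto simp: J_def R_def)
  qed (auto simp: R_def)
  moreover have "net_tendsto J R (\<lambda>i. norm_2_tr (snd (q i) (A * B) - snd (q i) A * snd (q i) B)) 0" for A B
    unfolding net_tendsto_def
  proof (intro allI impI)
    fix e :: real assume "e > 0"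
    then obtain n where n: "1 / real (Suc n) < e" by (rule nat_approx_posE)
    have "dist (norm_2_tr (snd (q i) (A * B) - snd (q i) A * snd (q i) B)) 0 < e"
      if i: "i \<in> J" "R ({A, B}, n) i" for i
    proof -
      have "\<bar>norm_2_tr (snd (q i) (A * B) - snd (q i) A * snd (q i) B)\<bar> < 1 / real (Suc (snd i))"
        using q[OF i(1)] i(2) by (auto simp: R_def)
      also have "\<dots> \<le> 1 / real (Suc n)" using i(2) by (auto simp: R_def frac_le)
      finally show ?thesis using n by simp
    qed
    then show "\<exists>i\<^sub>0\<in>J. \<forall>i\<in>J. R i\<^sub>0 i \<longrightarrow>
        dist (norm_2_tr (snd (q i) (A * B) - snd (q i) A * snd (q i) B)) 0 < e"
      by (intro bexI[of _ "({A, B}, n)"]) (auto simp: J_def)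
  qed
  ultimately have "folner_net J R (\<lambda>i. fst (q i)) (\<lambda>i. snd (q i))"
    using q by (simp add: folner_net_def)
  then show ?thesis by (rule folner_cstar_algebraI)
qed

end
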